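(* Let $n\ge 1$ and let $R=\dfrac{[\alpha_1][\alpha_2]}{[\beta_1][\beta_2]}$ be a ratio, where $\alpha_1,\alpha_2,\beta_1,\beta_2$ are index sets in $\{1,\ldots,2n\}$. The following are equivalent: (1) $R$ satisfies the ST0 condition and $$\max(|\alpha_1\cap L|,|\alpha_2\cap L|)\ \ge\ \max(|\beta_1\cap L|,|\beta_2\cap L|)$$ for every interval $L\subseteq\{1,\ldots,2n\}$ (i.e. $R$ satisfies condition (M)). (2) $R$ can be written as a product of basic ratios. (3) $R$ is bounded by $1$. (4) $R$ is bounded.
   Context: A real $n\times n$ matrix is totally positive if all of its minors are positive. An index set is an $n$-element subset of $\{1,\ldots,2n\}$. For a totally positive $n\times n$ matrix $A$, let $\bar A$ be the $2n\times n$ matrix whose upper $n\times n$ block is $A$ and whose lower $n\times n$ block has entry $(-1)^{k-1}$ in position $(k,n+1-k)$ for $k=1,\ldots,n$ and zeros elsewhere. For an index set $\alpha$, $[\alpha](A)$ is the determinant of the $n\times n$ submatrix of $\bar A$ formed by the rows indexed by $\alpha$ (in increasing order); these are exactly the minors of $A$, via $[I\cup\{2n+1-i: i\in\{1,\ldots,n\}\setminus I'\}](A)=\det A(I|I')$ for row set $I$ and column set $I'$ with $|I|=|I'|$ (and $1$ when $I=I'=\emptyset$), and all are positive. The ratio $R$ is bounded by $k>0$ if $[\alpha_1](A)[\alpha_2](A)\le k\,[\beta_1](A)[\beta_2](A)$ for all totally positive $n\times n$ matrices $A$, and bounded if it is bounded by some $k>0$. ST0 condition: for every $i\in\{1,\ldots,2n\}$,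 the number of indices $s\in\{1,2\}$ with $i\in\alpha_s$ equals the number of indices $s\in\{1,2\}$ with $i\in\beta_s$. Interval: a subset $L\subseteq\{1,\ldots,2n\}$ such that $L$ or its complement in $\{1,\ldots,2n\}$ has the form $\{i,i+1,\ldots,i+m\}$ (consecutive integers). Condition (M): for every interval $L$, the non-increasing rearrangement $(x_1,x_2)$ of $(|\alpha_1\cap L|,|\alpha_2\cap L|)$ majorizes the non-increasing rearrangement $(y_1,y_2)$ of $(|\beta_1\cap L|,|\beta_2\cap L|)$, i.e. $x_1\ge y_1$ and $x_1+x_2=y_1+y_2$. Write $[a,b,\Delta]$ for $[\{a,b\}\cup\Delta]$. A basic ratio is a ratio of the form $$\frac{[i,j+1,\Delta]\,[i+1,j,\Delta]}{[i,j,\Delta]\,[i+1,j+1,\Delta]}$$ where $i,j\in\{1,\ldots,2n\}$, $i+1$ and $j+1$ are read modulo $2n$ (with $2n+1$ read as $1$), $\Delta\subset\{1,\ldots,2n\}$ with $|\Delta|=n-2$, and $i,i+1,j,j+1$ are pairwise distinct and not in $\Delta$. Ratios are multiplied as formal quotients in the symbols $[\alpha]$, cancelling common factors; repeated factors are allowed in products, and the empty product equals $1$. *)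

theory Defs
  imports
    "Jordan_Normal_Form.Determinant"
    "Jordan_Normal_Form.DL_Submatrix"
    "HOL-Library.Poly_Mapping"
begin

text \<open>
  Index sets are sets of naturals in \<open>{1..2*n}\<close>, whereas library matrices
  are indexed from 0, so an element \<open>i\<close> of an index set selects the library row \<open>i - 1\<close>.
\<close>

definition totally_positive :: "nat \<Rightarrow> real mat \<Rightarrow> bool" where
  "totally_positive n A \<longleftrightarrow> A \<in> carrier_mat n n \<and>
     (\<forall>I J. I \<subseteq> {0..<n} \<and> J \<subseteq> {0..<n} \<and> card I = card J \<and> I \<noteq> {} \<longrightarrow>
        det (submatrix A I J) > 0)"

definition index_set :: "nat \<Rightarrow> nat set \<Rightarrow> bool" where
  "index_set n \<alpha> \<longleftrightarrow> \<alpha> \<subseteq> {1..2*n} \<and> card \<alpha> = n"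

text \<open>
  With 1-based \<open>k\<close>, the lower block has entry \<open>(-1)^(k-1)\<close> at \<open>(k, n+1-k)\<close>;
  with \<open>k = Suc r\<close> this is entry \<open>(-1)^r\<close> at the 0-based position \<open>(r, n-1-r)\<close>.
\<close>

definition lower_block :: "nat \<Rightarrow> real mat" where
  "lower_block n = mat n n (\<lambda>(r, c). if c = n - 1 - r then (-1) ^ r else 0)"

definition bar_mat :: "nat \<Rightarrow> real mat \<Rightarrow> real mat" where
  "bar_mat n A = A @\<^sub>r lower_block n"

definition bracket :: "nat \<Rightarrow> nat set \<Rightarrow> real mat \<Rightarrow> real" where
  "bracket n \<alpha> A = det (submatrix (bar_mat n A) ((\<lambda>i. i - 1) ` \<alpha>) UNIV)"

definition ratio_bounded_by ::
    "nat \<Rightarrow> real \<Rightarrow> nat set \<Rightarrow> nat set \<Rightarrow> nat set \<Rightarrow> nat set \<Rightarrow> bool" where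
  "ratio_bounded_by n k \<alpha>1 \<alpha>2 \<beta>1 \<beta>2 \<longleftrightarrow> k > 0 \<and>
     (\<forall>A. totally_positive n A \<longrightarrow>
        bracket n \<alpha>1 A * bracket n \<alpha>2 A \<le> k * (bracket n \<beta>1 A * bracket n \<beta>2 A))"

definition ratio_bounded ::
    "nat \<Rightarrow> nat set \<Rightarrow> nat set \<Rightarrow> nat set \<Rightarrow> nat set \<Rightarrow> bool" where
  "ratio_bounded n \<alpha>1 \<alpha>2 \<beta>1 \<beta>2 \<longleftrightarrow> (\<exists>k>0. ratio_bounded_by n k \<alpha>1 \<alpha>2 \<beta>1 \<beta>2)"

definition ST0 :: "nat \<Rightarrow> nat set \<Rightarrow> nat set \<Rightarrow> nat set \<Rightarrow> nat set \<Rightarrow> bool" where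
  "ST0 n \<alpha>1 \<alpha>2 \<beta>1 \<beta>2 \<longleftrightarrow>
     (\<forall>i\<in>{1..2*n}. length (filter (\<lambda>\<gamma>. i \<in> \<gamma>) [\<alpha>1, \<alpha>2]) =
                   length (filter (\<lambda>\<gamma>. i \<in> \<gamma>) [\<beta>1, \<beta>2]))"

definition cyclic_interval :: "nat \<Rightarrow> nat set \<Rightarrow> bool" where
  "cyclic_interval n L \<longleftrightarrow> L \<subseteq> {1..2*n} \<and>
     (\<exists>i m. L = {i..i + m} \<or> {1..2*n} - L = {i..i + m})"

definition interval_max_condition ::
    "nat \<Rightarrow> nat set \<Rightarrow> nat set \<Rightarrow> nat set \<Rightarrow> nat set \<Rightarrow> bool" where
  "interval_max_condition n \<alpha>1 \<alpha>2 \<beta>1 \<beta>2 \<longleftrightarrow>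
     (\<forall>L. cyclic_interval n L \<longrightarrow>
        max (card (\<alpha>1 \<inter> L)) (card (\<alpha>2 \<inter> L)) \<ge> max (card (\<beta>1 \<inter> L)) (card (\<beta>2 \<inter> L)))"

definition rearrange2 :: "nat \<Rightarrow> nat \<Rightarrow> nat \<times> nat" where
  "rearrange2 a b = (max a b, min a b)"

definition majorizes2 :: "nat \<times> nat \<Rightarrow> nat \<times> nat \<Rightarrow> bool" where
  "majorizes2 x y \<longleftrightarrow> fst x \<ge> fst y \<and> fst x + snd x = fst y + snd y"

definition condition_M :: "nat \<Rightarrow> nat set \<Rightarrow> nat set \<Rightarrow> nat set \<Rightarrow> nat set \<Rightarrow> bool" where
  "condition_M n \<alpha>1 \<alpha>2 \<beta>1 \<beta>2 \<longleftrightarrow>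
     (\<forall>L. cyclic_interval n L \<longrightarrow>
        majorizes2 (rearrange2 (card (\<alpha>1 \<inter> L)) (card (\<alpha>2 \<inter> L)))
                   (rearrange2 (card (\<beta>1 \<inter> L)) (card (\<beta>2 \<inter> L))))"

text \<open>
  Formal quotients of products of symbols \<open>[\<alpha>]\<close>, with common factors cancelled, form the free
  abelian group on these symbols. It is written additively: a quotient is the finitely supported
  map sending \<open>\<alpha>\<close> to the exponent of \<open>[\<alpha>]\<close>, so products become sums and the empty product is \<open>0\<close>.
\<close>

type_synonym formal_quotient = "nat set \<Rightarrow>\<^sub>0 int"

definition formal_ratio ::
    "nat set \<Rightarrow> nat set \<Rightarrow> nat set \<Rightarrow> nat set \<Rightarrow> formal_quotient" where
  "formal_ratio \<alpha>1 \<alpha>2 \<beta>1 \<beta>2 = (frag_of \<alpha>1 + frag_of \<alpha>2) - (frag_of \<beta>1 + frag_of \<beta>2)"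

definition cyc_succ :: "nat \<Rightarrow> nat \<Rightarrow> nat" where
  "cyc_succ n i = (if i = 2 * n then 1 else i + 1)"

text \<open>
  The condition \<open>card \<Delta> + 2 = n\<close> expresses \<open>card \<Delta> = n - 2\<close> without truncated subtraction.
\<close>

definition basic_ratio :: "nat \<Rightarrow> formal_quotient \<Rightarrow> bool" where
  "basic_ratio n q \<longleftrightarrow>
     (\<exists>i j \<Delta>. i \<in> {1..2*n} \<and> j \<in> {1..2*n} \<and> \<Delta> \<subseteq> {1..2*n} \<and> card \<Delta> + 2 = n \<and>
        distinct [i, cyc_succ n i, j, cyc_succ n j] \<and>
        {i, cyc_succ n i, j, cyc_succ n j} \<inter> \<Delta> = {} \<and>
        q = formal_ratio ({i, cyc_succ n j} \<union> \<Delta>) ({cyc_succ n i, j} \<union> \<Delta>)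
                         ({i, j} \<union> \<Delta>) ({cyc_succ n i, cyc_succ n j} \<union> \<Delta>))"

definition product_of_basic_ratios :: "nat \<Rightarrow> formal_quotient \<Rightarrow> bool" where
  "product_of_basic_ratios n q \<longleftrightarrow>
     (\<exists>qs. (\<forall>b\<in>set qs. basic_ratio n b) \<and> q = sum_list qs)"

end

theory Submission
  imports Defs
begin

text \<open>
  Going around the circle \<open>1, \<dots>, 2n\<close>, record \<open>+1\<close> at elements of \<open>\<alpha>1 - \<alpha>2\<close> and \<open>-1\<close> at elements of
  \<open>\<alpha>2 - \<alpha>1\<close>; the partial sums form a periodic height function. Given ST0, the interval condition says
  that height differences for \<open>\<alpha>\<close> dominate those for \<open>\<beta>\<close> in absolute value. At a peak of the \<open>\<alpha>\<close>-height,
  with neighbours \<open>p \<in> \<alpha>1\<close> and \<open>q \<in> \<alpha>2\<close>, write \<open>\<alpha>2 = q + B\<close> and, up to order, \<open>\<beta>2 = q + D\<close>. Then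
  \<open>[\<alpha>1][\<alpha>2] / [\<beta>1][\<beta>2]\<close> is \<open>[\<alpha>1][p + B] / [\<beta>1][p + D]\<close>, which still satisfies the condition and is treated
  by induction, times \<open>[q + B][p + D] / [q + D][p + B]\<close>. Because the heights start from a maximum, \<open>B - D\<close> and
  \<open>D - B\<close> form a ballot sequence along the circle from \<open>q\<close> to \<open>p\<close>; matching it splits the second factor into
  ratios with four moving elements, which telescope into basic ratios.

  Basic ratios are bounded by 1 by the three-term Pluecker relation and positivity of all brackets.
  Conversely, every \<open>2n \<times> n\<close> matrix with positive maximal minors becomes some \<open>bar_mat n A\<close>, up to a scalar on all
  brackets, after a change of basis. Applying this to Vandermonde matrices, rescaling rows forces ST0,
  and letting the nodes of an interval \<open>L\<close> collide forces the inequality for \<open>L\<close>, as the minor \<open>[\<gamma>]\<close> vanishes to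
  the strictly convex order \<open>binomial(|\<gamma> \<inter> L|, 2)\<close>.
\<close>

section \<open>Cyclic positions and products of basic ratios\<close>

text \<open>Unrolled positions on the circle, counted from 0: position \<open>k\<close> carries the
  element \<open>k + 1\<close> modulo \<open>2 * n\<close>. Arcs that pass from \<open>2 * n\<close>
  to 1 thus become ordinary intervals of naturals.\<close>

definition cyc :: "nat \<Rightarrow> nat \<Rightarrow> nat" where
  "cyc n k = Suc (k mod (2 * n))"

lemma cyc_succ_cyc: "n \<ge> 1 \<Longrightarrow> cyc_succ n (cyc n k) = cyc n (Suc k)"
  by (auto simp: cyc_succ_def cyc_def mod_Suc)

lemma cyc_in: "n \<ge> 1 \<Longrightarrow> cyc n k \<in> {1..2*n}"
  by (auto simp: cyc_def Suc_le_eq)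

lemma cyc_add: "cyc n (k + 2 * n) = cyc n k"
  by (simp add: cyc_def)

lemma cyc_neq:
  assumes "i < j" "j < i + 2 * n"
  shows "cyc n i \<noteq> cyc n j"
proof
  assume "cyc n i = cyc n j"
  then have "2 * n dvd j - i"
    using mod_eq_dvd_iff_nat[of i j "2*n"] assms by (auto simp: cyc_def)
  then show False
    using assms by (auto dest!: dvd_imp_le)
qed

text \<open>When the window moves from \<open>s\<close> to \<open>Suc s\<close>, the position
  \<open>s\<close> that drops out returns as \<open>s + 2 * n\<close>. This places any element
  relative to an arbitrary starting point.\<close>

lemma cyc_window:
  assumes "x \<in> {1..2*n}"
  shows "\<exists>k\<ge>s. k < s + 2 * n \<and> cyc n k = x"
proof (induction s)
  case 0
  then show ?case using assms by (intro exI[of _ "x - 1"]) (auto simp: cyc_def)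
next
  case (Suc s)
  then obtain k where k: "k \<ge> s" "k < s + 2 * n" "cyc n k = x" by blast
  then show ?case
    by (cases "k = s") (auto intro: exI[of _ "k + 2 * n"] exI[of _ k] simp: cyc_add)
qed

section \<open>Formal products of basic ratios\<close>

lemma product_of_basic_ratios_0: "product_of_basic_ratios n 0"
  unfolding product_of_basic_ratios_def by (rule exI[of _ "[]"]) simp

lemma product_of_basic_ratios_add:
  assumes "product_of_basic_ratios n q" "product_of_basic_ratios n r"
  shows "product_of_basic_ratios n (q + r)"
proof -
  obtain qs rs where "\<forall>b\<in>set qs. basic_ratio n b" "q = sum_list qs"
    "\<forall>b\<in>set rs. basic_ratio n b" "r = sum_list rs"
    using assms unfolding product_of_basic_ratios_def by blast
  then show ?thesis
    unfolding product_of_basic_ratios_def by (intro exI[of _ "qs @ rs"]) auto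
qed

lemma product_of_basic_ratios_basic: "basic_ratio n q \<Longrightarrow> product_of_basic_ratios n q"
  unfolding product_of_basic_ratios_def by (rule exI[of _ "[q]"]) simp

text \<open>
  Shortening one of the arcs \<open>i \<dots> j\<close>, \<open>k \<dots> l\<close> by an endpoint's neighbour \<open>e\<close> splits the ratio in two; if
  \<open>e \<in> \<Delta>\<close>, then in each factor \<open>e\<close> changes places with an end of the arc.
\<close>

lemma crossing_product:
  assumes "n \<ge> 1" "i < j" "j < k" "k < l" "l < i + 2 * n"
    and "\<Delta> \<subseteq> {1..2*n}" "card \<Delta> + 2 = n" "{cyc n i, cyc n j, cyc n k, cyc n l} \<inter> \<Delta> = {}"
  shows "product_of_basic_ratios n (formal_ratio
      ({cyc n i, cyc n l} \<union> \<Delta>) ({cyc n j, cyc n k} \<union> \<Delta>)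
      ({cyc n i, cyc n k} \<union> \<Delta>) ({cyc n j, cyc n l} \<union> \<Delta>))"
  using assms
proof (induction "(j - i) + (l - k)" arbitrary: i j k l \<Delta> rule: less_induct)
  case less
  define r where "r i j k l \<Delta> = formal_ratio
      ({cyc n i, cyc n l} \<union> \<Delta>) ({cyc n j, cyc n k} \<union> \<Delta>)
      ({cyc n i, cyc n k} \<union> \<Delta>) ({cyc n j, cyc n l} \<union> \<Delta>)" for i j k l \<Delta>
  have IH: "product_of_basic_ratios n (r i' j' k' l' \<Delta>')"
    if "(j' - i') + (l' - k') < (j - i) + (l - k)" "i' < j'" "j' < k'" "k' < l'" "l' < i' + 2 * n"
      "\<Delta>' \<subseteq> {1..2*n}" "card \<Delta>' + 2 = n" "{cyc n i', cyc n j', cyc n k', cyc n l'} \<inter> \<Delta>' = {}"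
    for i' j' k' l' \<Delta>'
    unfolding r_def using less.hyps[OF that(1) less.prems(1) that(2-)] .
  have fin: "finite \<Delta>" using less.prems(6) finite_subset by blast
  have neq: "cyc n a \<noteq> cyc n b" if "i \<le> a" "a < b" "b \<le> l" for a b
    using that less.prems by (intro cyc_neq) auto
  have card: "card (insert x (\<Delta> - {e})) = card \<Delta>" if "e \<in> \<Delta>" "x \<notin> \<Delta>" for x e
    using that fin card_gt_0_iff[of \<Delta>] by (auto simp: card_insert_if)
  have in_range: "cyc n x \<in> {1..2*n}" for x using cyc_in less.prems(1) by blast
  show ?case
  proof (cases "j = Suc i \<and> l = Suc k")
    case True
    have "basic_ratio n (r i j k l \<Delta>)"
      unfolding basic_ratio_def r_def
      by (rule exI[of _ "cyc n i"], rule exI[of _ "cyc n k"], rule exI[of _ \<Delta>])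
         (use True less.prems in_range in \<open>simp add: cyc_succ_cyc neq\<close>)
    then show ?thesis unfolding r_def by (rule product_of_basic_ratios_basic)
  next
    case False
    then consider "Suc i < j" | "Suc k < l" using less.prems by linarith
    then show ?thesis
    proof cases
      case 1
      let ?e = "Suc i"
      have n1: "cyc n ?e \<noteq> cyc n i" "cyc n ?e \<noteq> cyc n j" "cyc n ?e \<noteq> cyc n k" "cyc n ?e \<noteq> cyc n l"
         "cyc n i \<noteq> cyc n j" "cyc n i \<noteq> cyc n k" "cyc n i \<noteq> cyc n l" "cyc n j \<noteq> cyc n k" "cyc n j \<noteq> cyc n l"
        using 1 less.prems(2-5) by (simp_all add: neq neq[THEN not_sym])
      show ?thesis
      proof (cases "cyc n ?e \<in> \<Delta>")
        case False
        have "product_of_basic_ratios n (r i ?e k l \<Delta> + r ?e j k l \<Delta>)"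
          by (intro product_of_basic_ratios_add IH less.prems(6,7))
             (use 1 less.prems(2-5) in simp_all, use less.prems(8) False in auto)
        moreover have "r i ?e k l \<Delta> + r ?e j k l \<Delta> = r i j k l \<Delta>"
          by (simp add: r_def formal_ratio_def)
        ultimately show ?thesis by (simp add: r_def)
      next
        case True
        define \<Delta>0 where "\<Delta>0 = \<Delta> - {cyc n ?e}"
        have D: "\<Delta> = insert (cyc n ?e) \<Delta>0" using True by (auto simp: \<Delta>0_def)
        have "product_of_basic_ratios n (r ?e j k l (insert (cyc n i) \<Delta>0))"
        proof (rule IH)
          show "(insert (cyc n i) \<Delta>0) \<subseteq> {1..2*n}" using in_range less.prems(6) by (auto simp: \<Delta>0_def)
          show "card (insert (cyc n i) \<Delta>0) + 2 = n"
            using card[OF True, of "cyc n i"] less.prems(7,8) by (simp add: \<Delta>0_def)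
          show "{cyc n ?e, cyc n j, cyc n k, cyc n l} \<inter> (insert (cyc n i) \<Delta>0) = {}"
            using less.prems(8) n1 by (auto simp: \<Delta>0_def)
        qed (use 1 less.prems(2-5) in auto)
        moreover have "product_of_basic_ratios n (r i ?e k l (insert (cyc n j) \<Delta>0))"
        proof (rule IH)
          show "(insert (cyc n j) \<Delta>0) \<subseteq> {1..2*n}" using in_range less.prems(6) by (auto simp: \<Delta>0_def)
          show "card (insert (cyc n j) \<Delta>0) + 2 = n"
            using card[OF True, of "cyc n j"] less.prems(7,8) by (simp add: \<Delta>0_def)
          show "{cyc n i, cyc n ?e, cyc n k, cyc n l} \<inter> (insert (cyc n j) \<Delta>0) = {}"
            using less.prems(8) n1 by (auto simp: \<Delta>0_def)
        qed (use 1 less.prems(2-5) in auto)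
        ultimately have "product_of_basic_ratios n (r ?e j k l (insert (cyc n i) \<Delta>0) + r i ?e k l (insert (cyc n j) \<Delta>0))"
          by (rule product_of_basic_ratios_add)
        \<comment> \<open>The symbols containing both ends of the arc, \<open>[i, j, k]\<close> and
          \<open>[i, j, l]\<close> over \<open>\<Delta>0\<close>, each occur once in a numerator and
          once in a denominator and cancel.\<close>
        moreover have "r ?e j k l (insert (cyc n i) \<Delta>0) + r i ?e k l (insert (cyc n j) \<Delta>0) = r i j k l \<Delta>"
          by (simp add: r_def formal_ratio_def D insert_commute algebra_simps)
        ultimately show ?thesis by (simp add: r_def)
      qed
    next
      case 2
      let ?e = "Suc k"
      have n1: "cyc n ?e \<noteq> cyc n i" "cyc n ?e \<noteq> cyc n j" "cyc n ?e \<noteq> cyc n k" "cyc n ?e \<noteq> cyc n l"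
         "cyc n k \<noteq> cyc n l" "cyc n i \<noteq> cyc n k" "cyc n i \<noteq> cyc n l" "cyc n j \<noteq> cyc n k" "cyc n j \<noteq> cyc n l"
        using 2 less.prems(2-5) by (simp_all add: neq neq[THEN not_sym])
      show ?thesis
      proof (cases "cyc n ?e \<in> \<Delta>")
        case False
        have "product_of_basic_ratios n (r i j k ?e \<Delta> + r i j ?e l \<Delta>)"
          by (intro product_of_basic_ratios_add IH less.prems(6,7))
             (use 2 less.prems(2-5) in simp_all, use less.prems(8) False in auto)
        moreover have "r i j k ?e \<Delta> + r i j ?e l \<Delta> = r i j k l \<Delta>"
          by (simp add: r_def formal_ratio_def)
        ultimately show ?thesis by (simp add: r_def)
      next
        case True
        define \<Delta>0 where "\<Delta>0 = \<Delta> - {cyc n ?e}"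
        have D: "\<Delta> = insert (cyc n ?e) \<Delta>0" using True by (auto simp: \<Delta>0_def)
        have "product_of_basic_ratios n (r i j ?e l (insert (cyc n k) \<Delta>0))"
        proof (rule IH)
          show "(insert (cyc n k) \<Delta>0) \<subseteq> {1..2*n}" using in_range less.prems(6) by (auto simp: \<Delta>0_def)
          show "card (insert (cyc n k) \<Delta>0) + 2 = n"
            using card[OF True, of "cyc n k"] less.prems(7,8) by (simp add: \<Delta>0_def)
          show "{cyc n i, cyc n j, cyc n ?e, cyc n l} \<inter> (insert (cyc n k) \<Delta>0) = {}"
            using less.prems(8) n1 by (auto simp: \<Delta>0_def)
        qed (use 2 less.prems(2-5) in auto)
        moreover have "product_of_basic_ratios n (r i j k ?e (insert (cyc n l) \<Delta>0))"
        proof (rule IH)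
          show "(insert (cyc n l) \<Delta>0) \<subseteq> {1..2*n}" using in_range less.prems(6) by (auto simp: \<Delta>0_def)
          show "card (insert (cyc n l) \<Delta>0) + 2 = n"
            using card[OF True, of "cyc n l"] less.prems(7,8) by (simp add: \<Delta>0_def)
          show "{cyc n i, cyc n j, cyc n k, cyc n ?e} \<inter> (insert (cyc n l) \<Delta>0) = {}"
            using less.prems(8) n1 by (auto simp: \<Delta>0_def)
        qed (use 2 less.prems(2-5) in auto)
        ultimately have "product_of_basic_ratios n (r i j ?e l (insert (cyc n k) \<Delta>0) + r i j k ?e (insert (cyc n l) \<Delta>0))"
          by (rule product_of_basic_ratios_add)
        moreover have "r i j ?e l (insert (cyc n k) \<Delta>0) + r i j k ?e (insert (cyc n l) \<Delta>0) = r i j k l \<Delta>"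
          by (simp add: r_def formal_ratio_def D insert_commute algebra_simps)
        ultimately show ?thesis by (simp add: r_def)
      qed
    qed
  qed
qed

text \<open>The ballot condition gives the first element \<open>j\<close> of \<open>D - B\<close> an
  earlier partner \<open>i\<close> in \<open>B - D\<close>. Replacing \<open>i\<close> by
  \<open>j\<close> in \<open>B\<close> splits off a ratio of \<open>crossing_product\<close> and
  shrinks \<open>B - D\<close>, until \<open>B = D\<close> and the ratio is trivial.\<close>

lemma swap_product:
  assumes n: "n \<ge> 1" and st: "s < t" "t < s + 2 * n"
    and BD: "B \<subseteq> {1..2*n}" "D \<subseteq> {1..2*n}" "card B + 1 = n" "card D + 1 = n"
    and disj: "{cyc n s, cyc n t} \<inter> (B \<union> D) = {}"
    and agree: "\<And>k. t < k \<Longrightarrow> k < s + 2 * n \<Longrightarrow> cyc n k \<in> B \<longleftrightarrow> cyc n k \<in> D"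
    and ballot: "\<And>u. s < u \<Longrightarrow> u \<le> t \<Longrightarrow>
        0 \<le> (\<Sum>k\<in>{s<..<u}. of_bool (cyc n k \<in> B) - of_bool (cyc n k \<in> D) :: int)"
  shows "product_of_basic_ratios n (formal_ratio
      (insert (cyc n s) B) (insert (cyc n t) D) (insert (cyc n s) D) (insert (cyc n t) B))"
  using BD disj agree ballot
proof (induction "card (B - D)" arbitrary: B rule: less_induct)
  case less
  have fin: "finite B" "finite D" using less.prems(1,2) finite_subset by blast+
  \<comment> \<open>\<open>B\<close> and \<open>D\<close> agree on the arc from \<open>t\<close> to
    \<open>s + 2 * n\<close> and contain neither of its ends, so they differ only strictly between
    \<open>s\<close> and \<open>t\<close>.\<close>
  have pos: "\<exists>k. s < k \<and> k < t \<and> x = cyc n k" if "x \<in> (B - D) \<union> (D - B)" for x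
  proof -
    have x: "x \<in> {1..2*n}" using that less.prems by blast
    obtain k where k: "k \<ge> s" "k < s + 2 * n" "cyc n k = x" using cyc_window[OF x] by blast
    have "x \<noteq> cyc n s" "x \<noteq> cyc n t" using that less.prems(5) by auto
    with k have "k \<noteq> s" "k \<noteq> t" by auto
    moreover have "\<not> t < k" using less.prems(6)[of k] that k by auto
    ultimately show ?thesis using k by (intro exI[of _ k]) auto
  qed
  show ?case
  proof (cases "B = D")
    case True
    then show ?thesis by (simp add: formal_ratio_def product_of_basic_ratios_0)
  next
    case False
    have "\<not> D \<subseteq> B" using False fin less.prems(3,4) card_subset_eq[of B D] by auto
    then obtain y where "y \<in> D - B" by blast
    with pos obtain j0 where j0: "s < j0 \<and> j0 < t \<and> cyc n j0 \<in> D - B" by blast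
    define j where "j = (LEAST j. s < j \<and> j < t \<and> cyc n j \<in> D - B)"
    have j: "s < j" "j < t" "cyc n j \<in> D - B"
      using LeastI[of "\<lambda>j. s < j \<and> j < t \<and> cyc n j \<in> D - B", OF j0] by (auto simp: j_def)
    have j_least: "cyc n k \<notin> D - B" if "s < k" "k < j" for k
      using not_less_Least[of k "\<lambda>j. s < j \<and> j < t \<and> cyc n j \<in> D - B"] that j by (auto simp: j_def)
    define w where "w B k = (of_bool (cyc n k \<in> B) - of_bool (cyc n k \<in> D) :: int)" for B k
    \<comment> \<open>The partial sum through \<open>j\<close> is nonnegative although
      \<open>j\<close> contributes -1, so some earlier \<open>i\<close> contributes 1.\<close>
    have "0 \<le> sum (w B) {s<..<Suc j}" using less.prems(7)[of "Suc j"] j by (simp add: w_def)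
    also have "{s<..<Suc j} = insert j {s<..<j}" using j by auto
    finally have "1 \<le> sum (w B) {s<..<j}" using j by (simp add: w_def)
    then have "\<exists>i\<in>{s<..<j}. w B i > 0" 
      using sum_nonpos[of "{s<..<j}" "w B"] by (meson int_one_le_iff_zero_less linorder_not_le)
    then obtain i where i: "s < i" "i < j" "cyc n i \<in> B - D" by (auto simp: w_def split: if_splits)
    define Z where "Z = B - {cyc n i}"
    define B' where "B' = insert (cyc n j) Z"
    have B: "B = insert (cyc n i) Z" "cyc n i \<notin> Z" using i by (auto simp: Z_def)
    have neq: "cyc n a \<noteq> cyc n b" if "s \<le> a" "a < b" "b \<le> t" for a b
      using that st by (intro cyc_neq) auto
    have cardZ: "card Z + 2 = n" "card B' = card B" 
      using B j less.prems(3) fin by (auto simp: B'_def)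
    have sub: "B' \<subseteq> {1..2*n}" "Z \<subseteq> {1..2*n}" using j less.prems by (auto simp: B'_def Z_def)
    have "B' - D \<subset> B - D" using i j by (auto simp: B'_def Z_def)
    then have dec: "card (B' - D) < card (B - D)" using fin by (intro psubset_card_mono) auto
    \<comment> \<open>The element at \<open>s\<close> is read at its next position, so that the four
      moving elements come in the order \<open>i < j < t < s + 2 * n\<close>.\<close>
    have "product_of_basic_ratios n (formal_ratio
      ({cyc n i, cyc n (s + 2*n)} \<union> Z) ({cyc n j, cyc n t} \<union> Z)
      ({cyc n i, cyc n t} \<union> Z) ({cyc n j, cyc n (s + 2*n)} \<union> Z))"
      using n i j st cardZ sub less.prems(5) B
      by (intro crossing_product) (auto simp: cyc_add)
    moreover have "product_of_basic_ratios n (formal_ratio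
      (insert (cyc n s) B') (insert (cyc n t) D) (insert (cyc n s) D) (insert (cyc n t) B'))"
    proof (rule less.hyps[OF dec sub(1) less.prems(2)])
      show "card B' + 1 = n" "card D + 1 = n" using cardZ less.prems by auto
      show "{cyc n s, cyc n t} \<inter> (B' \<union> D) = {}" using less.prems(5) j by (auto simp: B'_def Z_def)
      show "(cyc n k \<in> B') = (cyc n k \<in> D)" if "t < k" "k < s + 2 * n" for k
      proof -
        have "cyc n i \<noteq> cyc n k" "cyc n j \<noteq> cyc n k" using cyc_neq[of i k n] cyc_neq[of j k n] that i j st by auto
        then show ?thesis using less.prems(6)[OF that] by (auto simp: B'_def Z_def)
      qed
      fix u assume u: "s < u" "u \<le> t"
      have other: "w B' k = w B k" if "s < k" "k < t" "k \<noteq> i" "k \<noteq> j" for k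
      proof -
        have "cyc n i \<noteq> cyc n k" using neq[of i k] neq[of k i] that i j by (cases k i rule: linorder_cases) auto
        moreover have "cyc n j \<noteq> cyc n k" using neq[of j k] neq[of k j] that i j by (cases k j rule: linorder_cases) auto
        ultimately show ?thesis by (auto simp: w_def B'_def Z_def)
      qed
      have ij: "w B i = 1" "w B j = -1" "w B' i = 0" "w B' j = 0"
        using i j neq[of i j] by (auto simp: w_def B'_def Z_def)
      \<comment> \<open>Up to \<open>j\<close> no term is negative, by minimality of
        \<open>j\<close>. Beyond \<open>j\<close> the changes at \<open>i\<close> and
        \<open>j\<close> cancel, and the ballot condition for \<open>B\<close> applies.\<close>
      have "0 \<le> sum (w B') {s<..<u}"
      proof (cases "u \<le> j")
        case True
        have "0 \<le> w B' k" if "k \<in> {s<..<u}" for k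
        proof (cases "k = i")
          case False
          then have "w B' k = w B k" using other[of k] that u True j by auto
          then show ?thesis using j_least[of k] that True by (auto simp: w_def)
        qed (simp add: ij)
        then show ?thesis by (intro sum_nonneg) auto
      next
        case False
        let ?K = "{s<..<u} - {i} - {j}"
        have "sum (w C) {s<..<u} = w C i + (w C j + sum (w C) ?K)" for C
          using False i j u by (subst sum.remove[of _ i], simp, simp, subst sum.remove[of _ j]) auto
        moreover have "sum (w B') ?K = sum (w B) ?K"
          using u by (intro sum.cong refl other) auto
        ultimately have "sum (w B') {s<..<u} = sum (w B) {s<..<u}" using ij by simp
        then show ?thesis using less.prems(7)[OF u] by (simp add: w_def)
      qed
      then show "0 \<le> (\<Sum>k\<in>{s<..<u}. of_bool (cyc n k \<in> B') - of_bool (cyc n k \<in> D) :: int)"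
        by (simp add: w_def)
    qed
    ultimately have "product_of_basic_ratios n (formal_ratio
        ({cyc n i, cyc n (s + 2*n)} \<union> Z) ({cyc n j, cyc n t} \<union> Z)
        ({cyc n i, cyc n t} \<union> Z) ({cyc n j, cyc n (s + 2*n)} \<union> Z)
      + formal_ratio
        (insert (cyc n s) B') (insert (cyc n t) D) (insert (cyc n s) D) (insert (cyc n t) B'))"
      by (rule product_of_basic_ratios_add)
    then show ?thesis
      unfolding cyc_add by (simp add: formal_ratio_def B B'_def insert_commute algebra_simps)
  qed
qed

section \<open>Height functions\<close>

definition step :: "nat \<Rightarrow> nat set \<Rightarrow> nat set \<Rightarrow> nat \<Rightarrow> int" where
  "step n \<gamma>1 \<gamma>2 k = of_bool (cyc n k \<in> \<gamma>1) - of_bool (cyc n k \<in> \<gamma>2)"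

definition height :: "nat \<Rightarrow> nat set \<Rightarrow> nat set \<Rightarrow> nat \<Rightarrow> int" where
  "height n \<gamma>1 \<gamma>2 t = (\<Sum>k<t. step n \<gamma>1 \<gamma>2 k)"

text \<open>The height difference along an arc is the difference of the two counts in it, and for a
  fixed sum of counts a larger maximum means a larger absolute difference. Since positions are
  unrolled, wrapping arcs are included.\<close>

definition dominates :: "nat \<Rightarrow> nat set \<Rightarrow> nat set \<Rightarrow> nat set \<Rightarrow> nat set \<Rightarrow> bool" where
  "dominates n \<alpha>1 \<alpha>2 \<beta>1 \<beta>2 \<longleftrightarrow>
     (\<forall>i j. \<bar>height n \<beta>1 \<beta>2 i - height n \<beta>1 \<beta>2 j\<bar> \<le> \<bar>height n \<alpha>1 \<alpha>2 i - height n \<alpha>1 \<alpha>2 j\<bar>)"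

lemma height_Suc: "height n \<gamma>1 \<gamma>2 (Suc t) = height n \<gamma>1 \<gamma>2 t + step n \<gamma>1 \<gamma>2 t"
  by (simp add: height_def)

lemma height_diff:
  "i \<le> j \<Longrightarrow> height n \<gamma>1 \<gamma>2 j - height n \<gamma>1 \<gamma>2 i = (\<Sum>k\<in>{i..<j}. step n \<gamma>1 \<gamma>2 k)"
  by (induction j rule: dec_induct) (auto simp: height_Suc)

lemma height_eq_card:
  "t \<le> 2 * n \<Longrightarrow> height n \<gamma>1 \<gamma>2 t = int (card (\<gamma>1 \<inter> {1..t})) - int (card (\<gamma>2 \<inter> {1..t}))"
proof (induction t)
  case 0
  then show ?case by (simp add: height_def)
next
  case (Suc t)
  have "card (\<gamma> \<inter> {1..Suc t}) = card (\<gamma> \<inter> {1..t}) + of_bool (Suc t \<in> \<gamma>)" for \<gamma>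
  proof -
    have "\<gamma> \<inter> {1..Suc t} = (if Suc t \<in> \<gamma> then insert (Suc t) (\<gamma> \<inter> {1..t}) else \<gamma> \<inter> {1..t})"
      by (auto simp: le_Suc_eq)
    then show ?thesis by simp
  qed
  moreover have "cyc n t = Suc t" using Suc.prems by (simp add: cyc_def)
  ultimately show ?case using Suc by (simp add: height_Suc step_def)
qed

lemma height_add_period:
  assumes "index_set n \<gamma>1" "index_set n \<gamma>2"
  shows "height n \<gamma>1 \<gamma>2 (t + 2 * n) = height n \<gamma>1 \<gamma>2 t"
proof (induction t)
  case 0
  have "\<gamma>1 \<inter> {1..2*n} = \<gamma>1" "\<gamma>2 \<inter> {1..2*n} = \<gamma>2" using assms by (auto simp: index_set_def)
  then have "height n \<gamma>1 \<gamma>2 (2 * n) = 0"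
    using assms by (simp add: height_eq_card index_set_def)
  then show ?case by (simp add: height_def)
next
  case (Suc t)
  then show ?case by (simp add: height_Suc step_def cyc_add)
qed

lemma height_cong:
  assumes "index_set n \<gamma>1" "index_set n \<gamma>2" "cyc n i = cyc n j"
  shows "height n \<gamma>1 \<gamma>2 i = height n \<gamma>1 \<gamma>2 j"
proof -
  have "height n \<gamma>1 \<gamma>2 (r + m * (2 * n)) = height n \<gamma>1 \<gamma>2 r" for r m
  proof (induction m)
    case (Suc m)
    have "r + Suc m * (2 * n) = (r + m * (2 * n)) + 2 * n" by simp
    then show ?case using Suc by (simp only: height_add_period[OF assms(1,2)])
  qed simp
  then have "height n \<gamma>1 \<gamma>2 k = height n \<gamma>1 \<gamma>2 (k mod (2 * n))" for k
    by (metis mod_div_mult_eq)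
  then show ?thesis using assms(3) by (metis cyc_def nat.inject)
qed

lemma height_swap: "height n \<gamma>2 \<gamma>1 t = - height n \<gamma>1 \<gamma>2 t"
  by (simp add: height_def step_def flip: sum_negf)

lemma dominates_swap: "dominates n \<alpha>1 \<alpha>2 \<beta>2 \<beta>1 \<longleftrightarrow> dominates n \<alpha>1 \<alpha>2 \<beta>1 \<beta>2"
  unfolding dominates_def height_swap[of n \<beta>1 \<beta>2] by (simp add: abs_minus_commute)

text \<open>The induction is on \<open>card (\<alpha>1 - \<alpha>2)\<close>: cutting off a peak puts
  \<open>p\<close> into the second set, so \<open>p\<close> leaves the difference. Once the
  difference is empty, equal cardinalities and balance make all four sets equal.\<close>

lemma product_if_dominates:
  assumes "n \<ge> 1" "index_set n \<alpha>1" "index_set n \<alpha>2" "index_set n \<beta>1" "index_set n \<beta>2"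
    and "\<And>x. of_bool (x \<in> \<alpha>1) + of_bool (x \<in> \<alpha>2) = (of_bool (x \<in> \<beta>1) + of_bool (x \<in> \<beta>2) :: int)"
    and "dominates n \<alpha>1 \<alpha>2 \<beta>1 \<beta>2"
  shows "product_of_basic_ratios n (formal_ratio \<alpha>1 \<alpha>2 \<beta>1 \<beta>2)"
  using assms
proof (induction "card (\<alpha>1 - \<alpha>2)" arbitrary: \<alpha>2 \<beta>1 \<beta>2 rule: less_induct)
  case less
  note n = less.prems(1) and \<alpha> = less.prems(2,3)
  have fin: "finite \<alpha>1" "finite \<alpha>2" using \<alpha> finite_subset by (auto simp: index_set_def)
  let ?H = "height n \<alpha>1 \<alpha>2"
  show ?case
  proof (cases "\<alpha>1 \<subseteq> \<alpha>2")
    case True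
    then have "\<alpha>1 = \<alpha>2" using \<alpha> fin card_subset_eq[of \<alpha>2 \<alpha>1] by (auto simp: index_set_def)
    moreover have "(x \<in> \<beta>1 \<longleftrightarrow> x \<in> \<alpha>1) \<and> (x \<in> \<beta>2 \<longleftrightarrow> x \<in> \<alpha>1)" for x
      using less.prems(6)[of x] \<open>\<alpha>1 = \<alpha>2\<close> by (auto simp: of_bool_def split: if_splits)
    ultimately have "\<beta>1 = \<alpha>1" "\<beta>2 = \<alpha>1" "\<alpha>2 = \<alpha>1" by blast+
    then show ?thesis by (simp add: formal_ratio_def product_of_basic_ratios_0)
  next
    case False
    then obtain x where x: "x \<in> \<alpha>1" "x \<notin> \<alpha>2" by blast
    then have xr: "x \<in> {1..2*n}" using \<alpha> by (auto simp: index_set_def)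
    have "\<exists>t0. \<forall>t. ?H t \<le> ?H t0"
    proof -
      have "0 \<in> {..<2*n}" using n by simp
      then have "finite (?H ` {..<2*n})" "?H ` {..<2*n} \<noteq> {}" by blast+
      then obtain t0 where t0: "?H t0 = Max (?H ` {..<2*n})" by (metis Max_in imageE)
      have "?H t \<le> ?H t0" for t
      proof -
        have "?H t = ?H (t mod (2 * n))" using \<alpha> by (intro height_cong) (auto simp: cyc_def)
        then show ?thesis using n by (auto simp: t0 intro!: Max_ge)
      qed
      then show ?thesis by blast
    qed
    then obtain t0 where t0: "\<And>t. ?H t \<le> ?H t0" by blast
    \<comment> \<open>\<open>s\<close> is the end of a plateau of maximal height. If there were
      none, the height would be constant from \<open>t0\<close> on, against the nonzero step at the
      element \<open>x\<close>.\<close>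
    have "\<exists>s. (\<forall>t. ?H t \<le> ?H s) \<and> ?H (Suc s) \<noteq> ?H s"
    proof (rule ccontr)
      assume neg: "\<nexists>s. (\<forall>t. ?H t \<le> ?H s) \<and> ?H (Suc s) \<noteq> ?H s"
      have const: "?H t = ?H t0" if "t0 \<le> t" for t
        using that by (induction t rule: dec_induct) (simp, metis neg t0)
      obtain k where "k \<ge> t0" "cyc n k = x" using cyc_window[OF xr] by blast
      then show False using const[of k] const[of "Suc k"] x by (simp add: height_Suc step_def)
    qed
    then obtain s where max: "\<And>t. ?H t \<le> ?H s" and s: "?H (Suc s) \<noteq> ?H s" by blast
    define q where "q = cyc n s"
    have q: "q \<notin> \<alpha>1" "q \<in> \<alpha>2"
      using max[of "Suc s"] s by (auto simp: height_Suc step_def q_def of_bool_def split: if_splits)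
    \<comment> \<open>\<open>t\<close> will be the last position before \<open>s + 2 * n\<close>
      where the two sets differ. From \<open>t + 1\<close> to \<open>s + 2 * n\<close> the height is
      constant, hence maximal, so the step at \<open>t\<close> goes up.\<close>
    define P where "P k \<longleftrightarrow> k < s + 2 * n \<and> (cyc n k \<in> \<alpha>1 \<longleftrightarrow> cyc n k \<notin> \<alpha>2)" for k
    define t where "t = Greatest P"
    have Pb: "\<And>k. P k \<Longrightarrow> k \<le> s + 2 * n" by (auto simp: P_def)
    obtain k where k: "k \<ge> s" "k < s + 2 * n" "cyc n k = x" using cyc_window[OF xr] by blast
    have "P k" using k x by (auto simp: P_def)
    then have Pt: "P t" "k \<le> t" unfolding t_def using Pb by (auto intro: GreatestI_nat Greatest_le_nat)
    have "k \<noteq> s" using k x q by (auto simp: q_def)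
    then have st: "s < t" "t < s + 2 * n" using k Pt by (auto simp: P_def)
    have after: "cyc n j \<in> \<alpha>1 \<longleftrightarrow> cyc n j \<in> \<alpha>2" if "t < j" "j < s + 2 * n" for j
      using Greatest_le_nat[of P j, OF _ Pb] that by (auto simp: P_def t_def)
    define p where "p = cyc n t"
    have "q \<noteq> p" using st by (auto simp: q_def p_def dest: cyc_neq)
    have "?H (s + 2 * n) - ?H (Suc t) = 0"
      using st after by (subst height_diff) (auto intro!: sum.neutral simp: step_def)
    then have Ht: "?H (Suc t) = ?H s" using height_add_period[OF \<alpha>] by simp
    have p: "p \<in> \<alpha>1" "p \<notin> \<alpha>2"
      using max[of t] Ht Pt by (auto simp: height_Suc step_def p_def P_def of_bool_def split: if_splits)
    have Ht': "?H t = ?H (Suc s)"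
      using Ht p q by (simp add: height_Suc step_def p_def q_def)
    \<comment> \<open>By symmetry of the denominator it suffices to treat the case
      \<open>q \<in> \<beta>2\<close>.\<close>
    have main: "product_of_basic_ratios n (formal_ratio \<alpha>1 \<alpha>2 \<beta>1 \<beta>2)"
      if \<beta>: "index_set n \<beta>1" "index_set n \<beta>2" and
         bal: "\<And>x. of_bool (x \<in> \<alpha>1) + of_bool (x \<in> \<alpha>2) = (of_bool (x \<in> \<beta>1) + of_bool (x \<in> \<beta>2) :: int)"
         and dom: "dominates n \<alpha>1 \<alpha>2 \<beta>1 \<beta>2" and q\<beta>: "q \<in> \<beta>2" for \<beta>1 \<beta>2
    proof -
      let ?K = "height n \<beta>1 \<beta>2"
      have domD: "\<bar>?K i - ?K j\<bar> \<le> \<bar>?H i - ?H j\<bar>" for i j using dom by (auto simp: dominates_def)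
      \<comment> \<open>Equal \<alpha>-heights at two positions force equal \<beta>-heights there.
        So the step of the \<beta>-height at \<open>t\<close> undoes its step down at
        \<open>s\<close>, which puts \<open>p\<close> into \<open>\<beta>1\<close>.\<close>
      have Kt: "?K t = ?K (Suc s)" "?K (Suc t) = ?K s"
        using domD[of t "Suc s"] domD[of "Suc t" s] Ht Ht' by auto
      have q1: "q \<notin> \<beta>1" using bal[of q] q q\<beta> by (auto simp: of_bool_def split: if_splits)
      have p1: "p \<in> \<beta>1" "p \<notin> \<beta>2"
        using bal[of p] p q\<beta> q1 Kt
        by (auto simp: height_Suc step_def q_def p_def of_bool_def split: if_splits)
      \<comment> \<open>An element in both or neither of the \<alpha> sets has multiplicity 2 or 0,
        hence lies in both or neither of the \<beta> sets.\<close>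
      have after': "cyc n j \<in> \<beta>1 \<longleftrightarrow> cyc n j \<in> \<beta>2" "cyc n j \<in> \<beta>2 \<longleftrightarrow> cyc n j \<in> \<alpha>2"
        if "t < j" "j < s + 2 * n" for j
        using after[OF that] bal[of "cyc n j"] by (auto simp: of_bool_def split: if_splits)
      define \<alpha>' where "\<alpha>' = insert p (\<alpha>2 - {q})"
      define \<beta>' where "\<beta>' = insert p (\<beta>2 - {q})"
      have qp_range: "q \<in> {1..2*n}" "p \<in> {1..2*n}" using cyc_in[OF n] by (auto simp: q_def p_def)
      have fin\<beta>: "finite \<beta>2" using \<beta> finite_subset by (auto simp: index_set_def)
      have card: "card (\<alpha>2 - {q}) + 1 = n" "card (\<beta>2 - {q}) + 1 = n"
        using \<alpha> \<beta> q q\<beta> n by (auto simp: index_set_def)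
      have idx: "index_set n \<alpha>'" "index_set n \<beta>'"
        using \<alpha> \<beta> p p1 card qp_range fin fin\<beta> by (auto simp: index_set_def \<alpha>'_def \<beta>'_def)
      have inner: "cyc n j \<noteq> q" "j \<noteq> t \<Longrightarrow> cyc n j \<noteq> p" if "s < j" "j < s + 2 * n" for j
        using that st cyc_neq[of s j n] cyc_neq[of j t n] cyc_neq[of t j n] unfolding q_def p_def
        by (auto, metis linorder_neqE_nat add_less_mono1 order.strict_trans)
      \<comment> \<open>Moving \<open>q\<close> to \<open>p\<close> cuts the peak off and leaves the rest of the height profile unchanged.\<close>
      have new_height: "height n \<gamma>1 \<gamma>' i - height n \<gamma>1 \<gamma>' (Suc s)
          = height n \<gamma>1 \<gamma>2 (if s < i \<and> i \<le> t then i else Suc s) - height n \<gamma>1 \<gamma>2 (Suc s)"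
        if "s \<le> i" "i < s + 2 * n" "\<gamma>' = insert p (\<gamma>2 - {q})" "p \<in> \<gamma>1" "q \<notin> \<gamma>1"
           "height n \<gamma>1 \<gamma>2 t = height n \<gamma>1 \<gamma>2 (Suc s)"
           "\<And>j. t < j \<Longrightarrow> j < s + 2 * n \<Longrightarrow> cyc n j \<in> \<gamma>1 \<longleftrightarrow> cyc n j \<in> \<gamma>2" for i \<gamma>1 \<gamma>2 \<gamma>'
        using that(1,2)
      proof (induction i rule: dec_induct)
        case base
        have "q \<notin> \<gamma>'" using that(3) \<open>q \<noteq> p\<close> by auto
        then show ?case using that(5) by (simp add: height_Suc step_def flip: q_def)
      next
        case (step i)
        have IH: "height n \<gamma>1 \<gamma>' i - height n \<gamma>1 \<gamma>' (Suc s)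
          = height n \<gamma>1 \<gamma>2 (if s < i \<and> i \<le> t then i else Suc s) - height n \<gamma>1 \<gamma>2 (Suc s)"
          using step by simp
        consider "i = s" | "s < i" "i < t" | "i = t" | "t < i" using step by linarith
        then show ?case
        proof cases
          case 1
          then show ?thesis using st by simp
        next
          case 2
          then have "step n \<gamma>1 \<gamma>' i = step n \<gamma>1 \<gamma>2 i"
            using inner[of i] st by (auto simp: step_def that(3))
          then show ?thesis using IH 2 by (simp add: height_Suc)
        next
          case 3
          then have "step n \<gamma>1 \<gamma>' i = 0" using that(3,4) by (simp add: step_def flip: p_def)
          then show ?thesis using IH 3 st that(6) by (simp add: height_Suc)
        next
          case 4
          then have "step n \<gamma>1 \<gamma>' i = 0"
            using inner[of i] st step.prems that(7)[of i] by (auto simp: step_def that(3))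
          then show ?thesis using IH 4 by (simp add: height_Suc)
        qed
      qed
      have dom': "dominates n \<alpha>1 \<alpha>' \<beta>1 \<beta>'"
        unfolding dominates_def
      proof (intro allI)
        fix i j
        obtain i1 where i1: "s \<le> i1" "i1 < s + 2 * n" "cyc n i1 = cyc n i"
          using cyc_window[OF cyc_in[OF n, of i]] by blast
        obtain j1 where j1: "s \<le> j1" "j1 < s + 2 * n" "cyc n j1 = cyc n j"
          using cyc_window[OF cyc_in[OF n, of j]] by blast
        \<comment> \<open>By \<open>new_height\<close> a new height difference is an old one between
          clipped positions, where everything in the window outside \<open>{s<..t}\<close> is sent
          to \<open>Suc s\<close>. Dominance is therefore inherited from the old heights.\<close>
        define i2 where "i2 = (if s < i1 \<and> i1 \<le> t then i1 else Suc s)"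
        define j2 where "j2 = (if s < j1 \<and> j1 \<le> t then j1 else Suc s)"
        have "height n \<alpha>1 \<alpha>' i - height n \<alpha>1 \<alpha>' j = ?H i2 - ?H j2"
          using height_cong[OF \<alpha>(1) idx(1) i1(3)] height_cong[OF \<alpha>(1) idx(1) j1(3)]
            new_height[OF i1(1,2) \<alpha>'_def p(1) q(1) Ht' after] new_height[OF j1(1,2) \<alpha>'_def p(1) q(1) Ht' after]
          unfolding i2_def j2_def by linarith
        moreover have "height n \<beta>1 \<beta>' i - height n \<beta>1 \<beta>' j = ?K i2 - ?K j2"
          using height_cong[OF \<beta>(1) idx(2) i1(3)] height_cong[OF \<beta>(1) idx(2) j1(3)]
            new_height[OF i1(1,2) \<beta>'_def p1(1) q1 Kt(1) after'(1)] new_height[OF j1(1,2) \<beta>'_def p1(1) q1 Kt(1) after'(1)]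
          unfolding i2_def j2_def by linarith
        ultimately show "\<bar>height n \<beta>1 \<beta>' i - height n \<beta>1 \<beta>' j\<bar> \<le> \<bar>height n \<alpha>1 \<alpha>' i - height n \<alpha>1 \<alpha>' j\<bar>"
          using domD[of i2 j2] by simp
      qed
      have bal': "of_bool (x \<in> \<alpha>1) + of_bool (x \<in> \<alpha>') = (of_bool (x \<in> \<beta>1) + of_bool (x \<in> \<beta>') :: int)" for x
        using bal[of x] p p1 q q1 q\<beta> by (cases "x = p"; cases "x = q") (auto simp: \<alpha>'_def \<beta>'_def)
      have "\<alpha>1 - \<alpha>' \<subset> \<alpha>1 - \<alpha>2" using p q by (auto simp: \<alpha>'_def)
      then have "card (\<alpha>1 - \<alpha>') < card (\<alpha>1 - \<alpha>2)" using fin by (intro psubset_card_mono) auto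
      then have R': "product_of_basic_ratios n (formal_ratio \<alpha>1 \<alpha>' \<beta>1 \<beta>')"
        using less.hyps[of \<alpha>' \<beta>1 \<beta>'] n \<alpha> \<beta> idx bal' dom' by blast
      have T: "product_of_basic_ratios n (formal_ratio (insert (cyc n s) (\<alpha>2 - {q}))
          (insert (cyc n t) (\<beta>2 - {q})) (insert (cyc n s) (\<beta>2 - {q})) (insert (cyc n t) (\<alpha>2 - {q})))"
      proof (rule swap_product[OF n st _ _ card])
        show "\<alpha>2 - {q} \<subseteq> {1..2*n}" "\<beta>2 - {q} \<subseteq> {1..2*n}" using \<alpha> \<beta> by (auto simp: index_set_def)
        show "{cyc n s, cyc n t} \<inter> (\<alpha>2 - {q} \<union> (\<beta>2 - {q})) = {}"
          using p p1 by (auto simp flip: q_def p_def)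
        show "(cyc n j \<in> \<alpha>2 - {q}) = (cyc n j \<in> \<beta>2 - {q})" if "t < j" "j < s + 2 * n" for j
          using after'[OF that] by auto
        fix u assume u: "s < u" "u \<le> t"
        define w where "w k = (of_bool (cyc n k \<in> \<alpha>2 - {q}) - of_bool (cyc n k \<in> \<beta>2 - {q}) :: int)" for k
        \<comment> \<open>By balance the indicator of \<open>\<alpha>1\<close> minus that of
          \<open>\<beta>1\<close> equals the indicator of \<open>\<beta>2\<close> minus that of
          \<open>\<alpha>2\<close>, which doubles the difference.\<close>
        have w: "step n \<alpha>1 \<alpha>2 k - step n \<beta>1 \<beta>2 k = - 2 * w k" if "k \<in> {s<..<u}" for k
          using bal[of "cyc n k"] inner(1)[of k] that u st by (auto simp: step_def w_def)
        have "(?H u - ?H s) - (?K u - ?K s) = (\<Sum>k\<in>{s..<u}. step n \<alpha>1 \<alpha>2 k - step n \<beta>1 \<beta>2 k)"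
          using u by (simp add: height_diff sum_subtractf)
        also have "{s..<u} = insert s {s<..<u}" using u by auto
        also have "(\<Sum>k\<in>\<dots>. step n \<alpha>1 \<alpha>2 k - step n \<beta>1 \<beta>2 k) = (\<Sum>k\<in>{s<..<u}. - 2 * w k)"
          using q q1 q\<beta> w by (simp add: step_def flip: q_def)
        also have "\<dots> = - 2 * sum w {s<..<u}" by (simp add: sum_distrib_left)
        \<comment> \<open>\<open>?H u - ?H s\<close> is nonpositive and at least as large in
          absolute value as \<open>?K u - ?K s\<close>, so their difference cannot be
          positive.\<close>
        finally have "0 \<le> sum w {s<..<u}" using max[of u] domD[of u s] by linarith
        then show "0 \<le> (\<Sum>k\<in>{s<..<u}. of_bool (cyc n k \<in> \<alpha>2 - {q}) - of_bool (cyc n k \<in> \<beta>2 - {q}) :: int)"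
          by (simp add: w_def)
      qed
      have "insert q (\<alpha>2 - {q}) = \<alpha>2" "insert q (\<beta>2 - {q}) = \<beta>2" using q q\<beta> by auto
      then have "formal_ratio \<alpha>1 \<alpha>2 \<beta>1 \<beta>2 = formal_ratio \<alpha>1 \<alpha>' \<beta>1 \<beta>' +
          formal_ratio (insert (cyc n s) (\<alpha>2 - {q}))
          (insert (cyc n t) (\<beta>2 - {q})) (insert (cyc n s) (\<beta>2 - {q})) (insert (cyc n t) (\<alpha>2 - {q}))"
        by (simp add: formal_ratio_def \<alpha>'_def \<beta>'_def flip: q_def p_def)
      then show ?thesis using product_of_basic_ratios_add[OF R' T] by simp
    qed
    show ?thesis
    proof (cases "q \<in> \<beta>2")
      case True
      then show ?thesis using main less.prems by blast
    next
      case False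
      then have "q \<in> \<beta>1" using less.prems(6)[of q] q by (auto simp: of_bool_def split: if_splits)
      then have "product_of_basic_ratios n (formal_ratio \<alpha>1 \<alpha>2 \<beta>2 \<beta>1)"
        using main[of \<beta>2 \<beta>1] less.prems by (simp add: dominates_swap add.commute)
      then show ?thesis by (simp add: formal_ratio_def add.commute)
    qed
  qed
qed

section \<open>Minors given by lists of rows and columns\<close>

text \<open>Lists instead of sets allow rows to be permuted, prepended and appended, and entries
  given by a function allow any numbering of the rows.\<close>

definition minor :: "(nat \<Rightarrow> nat \<Rightarrow> 'a :: comm_ring_1) \<Rightarrow> nat list \<Rightarrow> nat list \<Rightarrow> 'a" where
  "minor M xs ys = det (mat (length xs) (length ys) (\<lambda>(i, j). M (xs ! i) (ys ! j)))"

lemma minor_cong: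
  assumes "\<And>x y. x \<in> set xs \<Longrightarrow> y \<in> set ys \<Longrightarrow> M x y = N x y"
  shows "minor M xs ys = minor N xs ys"
  unfolding minor_def using assms by (intro arg_cong[of _ _ det] cong_mat) auto

lemma minor_map_rows: "minor M (map f xs) ys = minor (\<lambda>i. M (f i)) xs ys"
  unfolding minor_def by (intro arg_cong[of _ _ det] cong_mat) auto

lemma minor_upt:
  "length xs = n \<Longrightarrow> minor M xs [0..<n] = det (mat n n (\<lambda>(i, j). M (xs ! i) j))"
  unfolding minor_def by (intro arg_cong[of _ _ det] cong_mat) auto

text \<open>Laplace expansion along the last row, where only the column \<open>c\<close> can
  contribute.\<close>

lemma minor_snoc:
  assumes len: "length xs = length ys1 + length ys2"
    and zero: "\<And>y. y \<in> set ys1 \<union> set ys2 \<Longrightarrow> M k y = 0"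
  shows "minor M (xs @ [k]) (ys1 @ c # ys2) =
    (-1) ^ (length xs + length ys1) * M k c * minor M xs (ys1 @ ys2)"
proof -
  let ?m = "length xs" and ?l = "length ys1" and ?ys = "ys1 @ c # ys2"
  define A where "A = mat (Suc ?m) (Suc ?m) (\<lambda>(i, j). M ((xs @ [k]) ! i) (?ys ! j))"
  have A: "A \<in> carrier_mat (Suc ?m) (Suc ?m)" by (simp add: A_def)
  have zero': "A $$ (?m, j) = 0" if "j < Suc ?m" "j \<noteq> ?l" for j
  proof -
    have "?ys ! j \<in> set ys1 \<union> set ys2"
      using that len by (auto simp: nth_append nth_Cons split: nat.splits)
    then show ?thesis using that zero by (simp add: A_def)
  qed
  have "minor M (xs @ [k]) ?ys = det A" by (simp add: minor_def A_def len)
  also have "\<dots> = (\<Sum>j<Suc ?m. A $$ (?m, j) * cofactor A ?m j)"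
    by (rule laplace_expansion_row[OF A]) simp
  also have "\<dots> = (\<Sum>j<Suc ?m. if j = ?l then A $$ (?m, ?l) * cofactor A ?m ?l else 0)"
    using zero' by (intro sum.cong) auto
  also have "\<dots> = A $$ (?m, ?l) * cofactor A ?m ?l" using len by simp
  also have "A $$ (?m, ?l) = M k c" using len by (auto simp: A_def nth_append)
  also have "mat_delete A ?m ?l = mat ?m ?m (\<lambda>(i, j). M (xs ! i) ((ys1 @ ys2) ! j))"
    unfolding mat_delete_def using len
    by (intro eq_matI) (auto simp: A_def nth_append Suc_diff_le)
  then have "cofactor A ?m ?l = (-1) ^ (?m + ?l) * minor M xs (ys1 @ ys2)"
    unfolding cofactor_def minor_def using len by simp
  finally show ?thesis by (simp add: mult_ac)
qed

lemma minor_swap_adjacent: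
  assumes "length ys = length xs + length zs + 2"
  shows "minor M (xs @ v # u # zs) ys = - minor M (xs @ u # v # zs) ys"
proof -
  let ?m = "length xs" and ?n = "length ys"
  define A where "A = mat ?n ?n (\<lambda>(i, j). M ((xs @ u # v # zs) ! i) (ys ! j))"
  have "mat ?n ?n (\<lambda>(i, j). M ((xs @ v # u # zs) ! i) (ys ! j)) = swaprows ?m (Suc ?m) A"
  proof (rule eq_matI)
    fix i j assume "i < dim_row (swaprows ?m (Suc ?m) A)" "j < dim_col (swaprows ?m (Suc ?m) A)"
    then have ij: "i < ?n" "j < ?n" by (auto simp: A_def)
    consider "i < ?m" | "i = ?m" | "i = Suc ?m" | l where "i = Suc (Suc ?m) + l"
      by (metis add_Suc_right less_iff_Suc_add linorder_neqE_nat nat_less_le not_less_eq add.commute le_Suc_ex Suc_leI)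
    then show "mat ?n ?n (\<lambda>(i, j). M ((xs @ v # u # zs) ! i) (ys ! j)) $$ (i, j)
        = swaprows ?m (Suc ?m) A $$ (i, j)"
      using ij assms by cases (auto simp: A_def nth_append)
  qed (auto simp: A_def)
  moreover have "det (swaprows ?m (Suc ?m) A) = - det A"
    using assms by (intro det_swaprows[of _ ?n]) (auto simp: A_def)
  ultimately show ?thesis using assms by (simp add: minor_def A_def)
qed

text \<open>Moving \<open>x\<close> to its place passes every smaller entry once, and each pass is a
  swap of adjacent rows.\<close>

lemma minor_insort:
  assumes "sorted ds" "x \<notin> set ds" "length ys = length xs + length ds + 1"
  shows "minor M (xs @ x # ds) ys =
    (-1) ^ length (filter (\<lambda>d. d < x) ds) * minor M (xs @ insort x ds) ys"
  using assms
proof (induction ds arbitrary: xs)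
  case Nil
  then show ?case by simp
next
  case (Cons d ds)
  show ?case
  proof (cases "x \<le> d")
    case True
    then have "filter (\<lambda>e. e < x) (d # ds) = []"
      using Cons.prems(1) by (force simp: filter_empty_conv)
    then show ?thesis using True by simp
  next
    case False
    have "minor M (xs @ x # d # ds) ys = - minor M ((xs @ [d]) @ x # ds) ys"
      using minor_swap_adjacent[of ys xs ds M x d] Cons.prems by simp
    also have "minor M ((xs @ [d]) @ x # ds) ys =
        (-1) ^ length (filter (\<lambda>d. d < x) ds) * minor M ((xs @ [d]) @ insort x ds) ys"
      using Cons.prems by (intro Cons.IH) auto
    finally show ?thesis using False by simp
  qed
qed

section \<open>Change of basis in the columns and the three-term Pluecker relation\<close>

lemma det_nonzero_inverse:
  fixes W :: "'a :: field mat"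
  assumes "W \<in> carrier_mat n n" "det W \<noteq> 0"
  obtains G where "G \<in> carrier_mat n n" "W * G = 1\<^sub>m n" "G * W = 1\<^sub>m n"
  using det_non_zero_imp_unit[OF assms, of "()"] unfolding Units_def ring_mat_def by auto

lemma minor_mult:
  assumes "length xs = n" "G \<in> carrier_mat n n"
  shows "minor (\<lambda>i j. \<Sum>k<n. M i k * G $$ (k, j)) xs [0..<n] = minor M xs [0..<n] * det G"
proof -
  have "mat n n (\<lambda>(i, j). \<Sum>k<n. M (xs ! i) k * G $$ (k, j)) = mat n n (\<lambda>(i, j). M (xs ! i) j) * G"
    using assms by (intro eq_matI) (auto simp: scalar_prod_def atLeast0LessThan)
  then have "det (mat n n (\<lambda>(i, j). \<Sum>k<n. M (xs ! i) k * G $$ (k, j)))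
      = det (mat n n (\<lambda>(i, j). M (xs ! i) j)) * det G"
    using assms by (simp add: det_mult[of _ n])
  then show ?thesis using assms(1) by (simp add: minor_upt)
qed

lemma det_two: "A \<in> carrier_mat 2 2 \<Longrightarrow> det A = A $$ (0, 0) * A $$ (1, 1) - A $$ (0, 1) * A $$ (1, 0)"
  by (subst laplace_expansion_row[of _ 2 0])
     (auto simp: numeral_2_eq_2 cofactor_def det_single mat_delete_def)

text \<open>
  Multiplying by the inverse of the matrix with rows \<open>a, b, ds\<close> turns every minor with rows
  \<open>x, y, ds\<close> into a \<open>2 \<times> 2\<close> determinant.
\<close>

lemma minor_three_term:
  fixes M :: "nat \<Rightarrow> nat \<Rightarrow> 'a :: field"
  assumes len: "length ds + 2 = n" and nz: "minor M (a # b # ds) [0..<n] \<noteq> 0"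
  defines "D x y \<equiv> minor M (x # y # ds) [0..<n]"
  shows "D a b * D c d - D a c * D b d + D a d * D b c = 0"
proof -
  define W where "W = mat n n (\<lambda>(i, j). M ((a # b # ds) ! i) j)"
  have W: "W \<in> carrier_mat n n" by (simp add: W_def)
  have "det W \<noteq> 0" using nz len by (simp add: minor_upt W_def)
  then obtain G where G: "G \<in> carrier_mat n n" "W * G = 1\<^sub>m n" using det_nonzero_inverse[OF W] by blast
  have "det W * det G = 1" using det_mult[OF W G(1)] G(2) by simp
  then have G0: "det G \<noteq> 0" by auto
  define F where "F i j = (\<Sum>k<n. M i k * G $$ (k, j))" for i j
  have Fd: "F ((a # b # ds) ! i) j = (if i = j then 1 else 0)" if "i < n" "j < n" for i j
  proof -
    have "F ((a # b # ds) ! i) j = (W * G) $$ (i, j)"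
      using that G(1) by (simp add: F_def W_def scalar_prod_def atLeast0LessThan)
    then show ?thesis using that by (simp add: G(2))
  qed
  have D: "D x y * det G = F x 0 * F y 1 - F x 1 * F y 0" for x y
  proof -
    define P where "P = mat 2 2 (\<lambda>(i, j). F ([x, y] ! i) j)"
    define Q where "Q = mat 2 (n - 2) (\<lambda>(i, j). F ([x, y] ! i) (Suc (Suc j)))"
    have "D x y * det G = minor F (x # y # ds) [0..<n]"
      unfolding D_def F_def using len G(1) by (subst minor_mult) auto
    also have "\<dots> = det (mat n n (\<lambda>(i, j). F ((x # y # ds) ! i) j))"
      using len by (simp add: minor_upt)
    \<comment> \<open>The rows \<open>ds\<close> of \<open>F\<close> are the unit vectors for the
      columns from 2 on, so they form the block row of a zero block and an identity block.\<close>
    also have "mat n n (\<lambda>(i, j). F ((x # y # ds) ! i) j)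
        = four_block_mat P Q (0\<^sub>m (n - 2) 2) (1\<^sub>m (n - 2))"
    proof (rule eq_matI)
      fix i j
      assume "i < dim_row (four_block_mat P Q (0\<^sub>m (n - 2) 2) (1\<^sub>m (n - 2)))"
        "j < dim_col (four_block_mat P Q (0\<^sub>m (n - 2) 2) (1\<^sub>m (n - 2)))"
      then have ij: "i < n" "j < n" using len by (auto simp: P_def)
      show "mat n n (\<lambda>(i, j). F ((x # y # ds) ! i) j) $$ (i, j)
          = four_block_mat P Q (0\<^sub>m (n - 2) 2) (1\<^sub>m (n - 2)) $$ (i, j)"
      proof -
        have "i = 0 \<or> i = 1 \<or> (\<exists>i'. i = Suc (Suc i'))" "j = 0 \<or> j = 1 \<or> (\<exists>j'. j = Suc (Suc j'))"
          by presburger+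
        then show ?thesis using ij len Fd[OF ij] by (auto simp: P_def Q_def)
      qed
    qed (use len in \<open>auto simp: P_def\<close>)
    also have "det \<dots> = det P * det (1\<^sub>m (n - 2) :: 'a mat)"
      by (rule det_four_block_mat_lower_left_zero) (auto simp: P_def Q_def)
    also have "\<dots> = F x 0 * F y 1 - F x 1 * F y 0"
      using det_two[of P] by (simp add: P_def)
    finally show ?thesis .
  qed
  \<comment> \<open>Scaling by \<open>det G\<close> twice turns every \<open>D\<close> into a 2 by 2
    determinant, for which the relation is a polynomial identity.\<close>
  have "(D a b * D c d - D a c * D b d + D a d * D b c) * (det G * det G) =
    (D a b * det G) * (D c d * det G) - (D a c * det G) * (D b d * det G)
      + (D a d * det G) * (D b c * det G)" by (simp add: algebra_simps)
  also have "\<dots> = 0" unfolding D by (simp add: algebra_simps)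
  finally show ?thesis using G0 by simp
qed

section \<open>Library submatrices as minors over sorted index lists\<close>

lemma pick_eq_nth_sorted_list:
  assumes "finite I" "i < card I"
  shows "pick I i = sorted_list_of_set I ! i"
proof -
  let ?xs = "sorted_list_of_set I"
  have strict: "sorted_wrt (<) ?xs" by simp
  have len: "length ?xs = card I" by simp
  \<comment> \<open>\<open>pick\<close> finds an element from the number of smaller ones, and
    exactly the entries before position \<open>i\<close> are smaller than
    \<open>?xs ! i\<close>.\<close>
  have "{a \<in> I. a < ?xs ! i} = (!) ?xs ` {..<i}"
  proof (intro equalityI subsetI)
    fix a assume "a \<in> {a \<in> I. a < ?xs ! i}"
    then obtain k where "k < card I" "a = ?xs ! k" "?xs ! k < ?xs ! i"
      using assms(1) len by (metis (mono_tags, lifting) in_set_conv_nth mem_Collect_eq set_sorted_list_of_set)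
    moreover have "k < i"
    proof (rule ccontr)
      assume "\<not> k < i"
      then have "?xs ! i \<le> ?xs ! k"
        using \<open>k < card I\<close> sorted_nth_mono[of ?xs i k] by simp
      then show False using \<open>?xs ! k < ?xs ! i\<close> by simp
    qed
    ultimately show "a \<in> (!) ?xs ` {..<i}" by auto
  next
    fix a assume "a \<in> (!) ?xs ` {..<i}"
    then obtain k where k: "k < i" "a = ?xs ! k" by auto
    then have "?xs ! k \<in> set ?xs" using assms by (intro nth_mem) simp
    moreover have "?xs ! k < ?xs ! i" using sorted_wrt_nth_less[OF strict k(1)] assms by simp
    ultimately show "a \<in> {a \<in> I. a < ?xs ! i}" using k assms(1) by simp
  qed
  moreover have "inj_on ((!) ?xs) {..<i}"
    using assms by (intro inj_on_nth) auto
  ultimately have "card {a \<in> I. a < ?xs ! i} = i" by (simp add: card_image)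
  moreover have "?xs ! i \<in> I" using assms by (metis len nth_mem set_sorted_list_of_set)
  ultimately show ?thesis using pick_card_in_set[of "?xs ! i" I] by simp
qed

lemma det_submatrix_eq_minor:
  assumes "I \<subseteq> {..<dim_row A}" "J \<subseteq> {..<dim_col A}"
  shows "det (submatrix A I J) = minor (\<lambda>i j. A $$ (i, j)) (sorted_list_of_set I) (sorted_list_of_set J)"
proof -
  have fin: "finite I" "finite J" using assms finite_subset by blast+
  have "{i. i < dim_row A \<and> i \<in> I} = I" "{j. j < dim_col A \<and> j \<in> J} = J" using assms by auto
  then show ?thesis
    unfolding submatrix_def minor_def using fin
    by (intro arg_cong[of _ _ det] cong_mat) (auto simp: pick_eq_nth_sorted_list)
qed

section \<open>Brackets as minors\<close>

text \<open>Rows are numbered from 1 like the elements of index sets, columns from 0.\<close>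

definition bar_entry :: "nat \<Rightarrow> real mat \<Rightarrow> nat \<Rightarrow> nat \<Rightarrow> real" where
  "bar_entry n A i j =
     (if i \<le> n then A $$ (i - 1, j) else if j = 2 * n - i then (-1) ^ (i - n - 1) else 0)"

lemma bar_mat_index:
  assumes "A \<in> carrier_mat n n" "i \<in> {1..2*n}" "j < n"
  shows "bar_mat n A $$ (i - 1, j) = bar_entry n A i j"
  using assms by (auto simp: bar_mat_def append_rows_def lower_block_def bar_entry_def)

lemma sorted_list_of_set_image_diff_1:
  assumes "\<alpha> \<subseteq> {1..(m::nat)}"
  shows "sorted_list_of_set ((\<lambda>i. i - 1) ` \<alpha>) = map (\<lambda>i. i - 1) (sorted_list_of_set \<alpha>)"
proof -
  have fin: "finite \<alpha>" using assms finite_subset by blast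
  have "sorted_wrt (\<lambda>i j. i - 1 < j - 1) (sorted_list_of_set \<alpha>)"
    by (rule sorted_wrt_mono_rel[of _ "(<)"]) (use assms fin in \<open>force+\<close>)
  then have "sorted_wrt (<) (map (\<lambda>i. i - 1) (sorted_list_of_set \<alpha>))" by (simp add: sorted_wrt_map)
  then show ?thesis using fin by (intro strict_sorted_equal) auto
qed

lemma bracket_eq_minor:
  assumes "A \<in> carrier_mat n n" "index_set n \<alpha>"
  shows "bracket n \<alpha> A = minor (bar_entry n A) (sorted_list_of_set \<alpha>) [0..<n]"
proof -
  have \<alpha>: "\<alpha> \<subseteq> {1..2*n}" using assms by (simp add: index_set_def)
  have fin: "finite \<alpha>" using \<alpha> finite_subset by blast
  have dim: "dim_row (bar_mat n A) = 2 * n" "dim_col (bar_mat n A) = n"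
    using assms by (auto simp: bar_mat_def append_rows_def lower_block_def)
  \<comment> \<open>The column set is first cut down to the actual columns, because
    \<open>det_submatrix_eq_minor\<close> requires one inside the column range.\<close>
  have "submatrix (bar_mat n A) ((\<lambda>i. i - 1) ` \<alpha>) UNIV
      = submatrix (bar_mat n A) ((\<lambda>i. i - 1) ` \<alpha>) {..<n}"
    unfolding submatrix_def dim
    by (intro cong_mat) (auto simp: pick_UNIV pick_eq_nth_sorted_list lessThan_atLeast0)
  then have "bracket n \<alpha> A = minor (\<lambda>i j. bar_mat n A $$ (i, j))
      (sorted_list_of_set ((\<lambda>i. i - 1) ` \<alpha>)) (sorted_list_of_set {..<n})"
    unfolding bracket_def using \<alpha> dim by (subst det_submatrix_eq_minor[symmetric]) force+
  also have "sorted_list_of_set {..<n} = [0..<n]" by (simp add: lessThan_atLeast0)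
  finally show ?thesis
    unfolding sorted_list_of_set_image_diff_1[OF \<alpha>] minor_map_rows
    using bar_mat_index[OF assms(1)] \<alpha> fin
    by (auto intro!: minor_cong simp del: atLeastAtMost_iff)
qed

text \<open>
  The nonzero entries of the lower block move left as the row index grows, so expanding along
  the last row always hits the leftmost of the columns already deleted; there the cofactor sign
  cancels the sign of the entry.
\<close>

lemma minor_lower_rows:
  assumes "sorted_wrt (<) ks" "set ks \<subseteq> {n<..2*n}" "sorted_wrt (<) ys" "set ys \<subseteq> {..<n}"
    and "length ys = length is + length ks" "\<And>k. k \<in> set ks \<Longrightarrow> 2 * n - k \<in> set ys"
    and "\<And>k c. k \<in> set ks \<Longrightarrow> c < n \<Longrightarrow> c \<notin> set ys \<Longrightarrow> c < 2 * n - k"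
  shows "minor (bar_entry n A) (is @ ks) ys =
    minor (bar_entry n A) is (filter (\<lambda>y. y \<notin> (\<lambda>k. 2 * n - k) ` set ks) ys)"
  using assms
proof (induction ks arbitrary: ys rule: rev_induct)
  case Nil
  then show ?case by simp
next
  case (snoc k ks)
  let ?c = "2 * n - k"
  have k: "n < k" "k \<le> 2 * n" using snoc.prems(2) by auto
  have lt: "k' < k" if "k' \<in> set ks" for k' using snoc.prems(1) that by (auto simp: sorted_wrt_append)
  have "?c \<in> set ys" using snoc.prems(6)[of k] by simp
  then obtain ys1 ys2 where ys: "ys = ys1 @ ?c # ys2" by (meson split_list)
  have ys_sorted: "sorted_wrt (<) ys1" "sorted_wrt (<) ys2" "\<And>y. y \<in> set ys1 \<Longrightarrow> y < ?c"
     "\<And>y. y \<in> set ys2 \<Longrightarrow> ?c < y" "\<And>x y. x \<in> set ys1 \<Longrightarrow> y \<in> set ys2 \<Longrightarrow> x < y"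
    using snoc.prems(3) unfolding ys by (auto simp: sorted_wrt_append)
  have "distinct ys" using snoc.prems(3) strict_sorted_iff by blast
  then have "card ({..<n} - set ys) = n - length ys"
    using snoc.prems(4) by (subst card_Diff_subset) (auto simp: distinct_card)
  \<comment> \<open>All deleted columns lie left of \<open>?c\<close>, so the columns below
    \<open>?c\<close> are \<open>ys1\<close> together with the \<open>n - length ys\<close> deleted
    ones. This count gives \<open>length ys1\<close>, and with it the parity in
    \<open>sgn\<close>.\<close>
  moreover have "{..<?c} = set ys1 \<union> ({..<n} - set ys)"
    using ys_sorted(3,4) snoc.prems(4,7) k unfolding ys by fastforce
  then have "?c = card (set ys1 \<union> ({..<n} - set ys))" by (metis card_lessThan)
  moreover have "card (set ys1 \<union> ({..<n} - set ys)) = length ys1 + card ({..<n} - set ys)"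
    using \<open>distinct ys\<close> unfolding ys by (subst card_Un_disjoint) (auto simp: distinct_card)
  moreover have "length ys \<le> n"
    using \<open>distinct ys\<close> snoc.prems(4) by (metis card_lessThan card_mono distinct_card finite_lessThan)
  ultimately have c: "?c + length ys = length ys1 + n" by linarith
  have sgn: "even (length (is @ ks) + length ys1 + (k - n - 1))"
  proof -
    have "length ys = Suc (length (is @ ks))" using snoc.prems(5) by simp
    then have *: "length (is @ ks) + length ys1 + (k - n - 1) = 2 * length (is @ ks)"
      using c k by linarith
    show ?thesis unfolding * by (rule dvd_triv_left)
  qed
  have "minor (bar_entry n A) ((is @ ks) @ [k]) (ys1 @ ?c # ys2) =
      (-1) ^ (length (is @ ks) + length ys1) * bar_entry n A k ?c * minor (bar_entry n A) (is @ ks) (ys1 @ ys2)"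
    using snoc.prems(5) ys_sorted(3,4) k
    by (intro minor_snoc) (force simp: ys bar_entry_def)+
  also have "(-1) ^ (length (is @ ks) + length ys1) * bar_entry n A k ?c = 1"
    using k sgn by (simp add: bar_entry_def flip: power_add)
  also have "minor (bar_entry n A) (is @ ks) (ys1 @ ys2) =
      minor (bar_entry n A) is (filter (\<lambda>y. y \<notin> (\<lambda>k. 2 * n - k) ` set ks) (ys1 @ ys2))"
  proof (rule snoc.IH)
    show "sorted_wrt (<) ks" using snoc.prems(1) by (simp add: sorted_wrt_append)
    show "set ks \<subseteq> {n<..2*n}" using snoc.prems(2) by simp
    show "sorted_wrt (<) (ys1 @ ys2)" using ys_sorted by (auto simp: sorted_wrt_append)
    show "set (ys1 @ ys2) \<subseteq> {..<n}" using snoc.prems(4) ys by auto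
    show "length (ys1 @ ys2) = length is + length ks" using snoc.prems(5) ys by simp
    show "2 * n - k' \<in> set (ys1 @ ys2)" if "k' \<in> set ks" for k'
      using snoc.prems(6)[of k'] lt[OF that] that k ys by auto
    show "c < 2 * n - k'" if "k' \<in> set ks" "c < n" "c \<notin> set (ys1 @ ys2)" for k' c
    proof (cases "c = ?c")
      case True
      then show ?thesis using lt[OF that(1)] k by linarith
    next
      case False
      then show ?thesis using snoc.prems(7)[of k' c] that ys by auto
    qed
  qed
  also have "filter (\<lambda>y. y \<notin> (\<lambda>k. 2 * n - k) ` set ks) (ys1 @ ys2)
      = filter (\<lambda>y. y \<notin> (\<lambda>k. 2 * n - k) ` set (ks @ [k])) ys"
    using ys_sorted(3,4) by (auto simp: ys intro!: arg_cong2[of _ _ _ _ append] filter_cong)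
  finally show ?case by (simp add: ys)
qed

text \<open>\<open>minor_lower_rows\<close> removes the rows of \<open>\<alpha>\<close> beyond
  \<open>n\<close>: row \<open>k\<close> deletes the column \<open>2 * n - k\<close>, counted from
  0, and what is left is a minor of \<open>A\<close>.\<close>

lemma bracket_eq_det_submatrix:
  assumes A: "A \<in> carrier_mat n n" and \<alpha>: "index_set n \<alpha>"
  shows "bracket n \<alpha> A = det (submatrix A ((\<lambda>i. i - 1) ` (\<alpha> \<inter> {1..n}))
      ({..<n} - (\<lambda>k. 2 * n - k) ` (\<alpha> \<inter> {n<..2*n})))"
proof -
  define I where "I = \<alpha> \<inter> {1..n}"
  define K where "K = \<alpha> \<inter> {n<..2*n}"
  let ?J = "{..<n} - (\<lambda>k. 2 * n - k) ` K"
  have fin: "finite I" "finite K" by (auto simp: I_def K_def)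
  have split: "\<alpha> = I \<union> K" "I \<inter> K = {}" using \<alpha> by (auto simp: I_def K_def index_set_def)
  have card: "card I + card K = n" using \<alpha> split fin by (metis card_Un_disjoint index_set_def)
  have "sorted_wrt (<) (sorted_list_of_set I @ sorted_list_of_set K)"
    using fin by (auto simp: sorted_wrt_append I_def K_def)
  then have sl: "sorted_list_of_set \<alpha> = sorted_list_of_set I @ sorted_list_of_set K"
    using fin split by (intro strict_sorted_equal) auto
  have "bracket n \<alpha> A = minor (bar_entry n A) (sorted_list_of_set I @ sorted_list_of_set K) [0..<n]"
    using bracket_eq_minor[OF A \<alpha>] sl by simp
  also have "\<dots> = minor (bar_entry n A) (sorted_list_of_set I)
      (filter (\<lambda>y. y \<notin> (\<lambda>k. 2 * n - k) ` set (sorted_list_of_set K)) [0..<n])"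
    using fin card by (intro minor_lower_rows) (auto simp: K_def)
  also have "filter (\<lambda>y. y \<notin> (\<lambda>k. 2 * n - k) ` set (sorted_list_of_set K)) [0..<n] = sorted_list_of_set ?J"
    using fin by (intro strict_sorted_equal) (auto simp: sorted_wrt_filter)
  also have "minor (bar_entry n A) (sorted_list_of_set I) (sorted_list_of_set ?J)
      = minor (\<lambda>i. (\<lambda>i j. A $$ (i, j)) (i - 1)) (sorted_list_of_set I) (sorted_list_of_set ?J)"
    using fin by (intro minor_cong) (auto simp: bar_entry_def I_def)
  also have "\<dots> = minor (\<lambda>i j. A $$ (i, j)) (sorted_list_of_set ((\<lambda>i. i - 1) ` I)) (sorted_list_of_set ?J)"
    by (subst sorted_list_of_set_image_diff_1[of I n], simp add: I_def, simp add: minor_map_rows)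
  also have "\<dots> = det (submatrix A ((\<lambda>i. i - 1) ` I) ?J)"
    using A by (subst det_submatrix_eq_minor) (auto simp: I_def)
  finally show ?thesis by (simp add: I_def K_def)
qed

lemma card_complement_columns:
  assumes "index_set n \<alpha>"
  shows "card ((\<lambda>i. i - 1) ` (\<alpha> \<inter> {1..n})) = card ({..<n} - (\<lambda>k. 2 * n - k) ` (\<alpha> \<inter> {n<..2*n}))"
proof -
  define I where "I = \<alpha> \<inter> {1..n}"
  define K where "K = \<alpha> \<inter> {n<..2*n}"
  have fin: "finite I" "finite K" by (auto simp: I_def K_def)
  have split: "\<alpha> = I \<union> K" "I \<inter> K = {}" using assms by (auto simp: I_def K_def index_set_def)
  have card: "card I + card K = n" using assms split fin by (metis card_Un_disjoint index_set_def)
  have "card ((\<lambda>i. i - 1) ` I) = card I" by (intro card_image inj_onI) (auto simp: I_def)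
  moreover have "card ((\<lambda>k. 2 * n - k) ` K) = card K" by (intro card_image inj_onI) (auto simp: K_def)
  moreover have "card ({..<n} - (\<lambda>k. 2 * n - k) ` K) = n - card ((\<lambda>k. 2 * n - k) ` K)"
    using fin by (subst card_Diff_subset) (auto simp: K_def)
  ultimately show ?thesis using card by (simp add: I_def K_def)
qed

lemma bracket_pos:
  assumes "totally_positive n A" "index_set n \<alpha>"
  shows "bracket n \<alpha> A > 0"
proof -
  have A: "A \<in> carrier_mat n n" using assms by (simp add: totally_positive_def)
  define I where "I = (\<lambda>i. i - 1) ` (\<alpha> \<inter> {1..n})"
  define J where "J = {..<n} - (\<lambda>k. 2 * n - k) ` (\<alpha> \<inter> {n<..2*n})"
  have IJ: "I \<subseteq> {0..<n}" "J \<subseteq> {0..<n}" "card I = card J"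
    using card_complement_columns[OF assms(2)] by (auto simp: I_def J_def)
  have "det (submatrix A I J) > 0"
  proof (cases "I = {}")
    \<comment> \<open>Total positivity speaks only of nonempty minors; the empty minor has
      determinant 1.\<close>
    case True
    then have "J = {}" using IJ finite_subset[of J "{0..<n}"] by auto
    then show ?thesis using True by (simp add: submatrix_def)
  next
    case False
    then show ?thesis using IJ assms(1) unfolding totally_positive_def by blast
  qed
  then show ?thesis by (simp add: bracket_eq_det_submatrix[OF A assms(2)] I_def J_def)
qed

lemma totally_positiveI:
  assumes A: "A \<in> carrier_mat n n" and pos: "\<And>\<alpha>. index_set n \<alpha> \<Longrightarrow> bracket n \<alpha> A > 0"
  shows "totally_positive n A"
  unfolding totally_positive_def
proof (intro conjI allI impI A)
  fix I J assume IJ: "I \<subseteq> {0..<n} \<and> J \<subseteq> {0..<n} \<and> card I = card J \<and> I \<noteq> {}"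
  \<comment> \<open>This inverts the correspondence of \<open>bracket_eq_det_submatrix\<close>: the
    rows \<open>I\<close> renumbered from 1, and one lower row for each column outside
    \<open>J\<close>.\<close>
  define \<alpha> where "\<alpha> = Suc ` I \<union> (\<lambda>j. 2 * n - j) ` ({..<n} - J)"
  have fin: "finite I" "finite J" using IJ finite_subset by blast+
  have "card (Suc ` I) = card I" by (simp add: card_image)
  moreover have "card ((\<lambda>j. 2 * n - j) ` ({..<n} - J)) = card ({..<n} - J)"
    by (intro card_image inj_onI) auto
  moreover have "card ({..<n} - J) = n - card J" "card J \<le> n"
    using IJ fin card_mono[of "{0..<n}" J] by (subst card_Diff_subset, auto)
  moreover have "Suc ` I \<inter> (\<lambda>j. 2 * n - j) ` ({..<n} - J) = {}" using IJ by force
  ultimately have "card \<alpha> = n" unfolding \<alpha>_def using IJ fin by (subst card_Un_disjoint) auto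
  then have \<alpha>: "index_set n \<alpha>" using IJ by (force simp: index_set_def \<alpha>_def)
  have "\<alpha> \<inter> {1..n} = Suc ` I" using IJ by (force simp: \<alpha>_def)
  then have "(\<lambda>i. i - 1) ` (\<alpha> \<inter> {1..n}) = I" by (simp add: image_image)
  moreover have "\<alpha> \<inter> {n<..2*n} = (\<lambda>j. 2 * n - j) ` ({..<n} - J)" using IJ by (force simp: \<alpha>_def)
  then have "{..<n} - (\<lambda>k. 2 * n - k) ` (\<alpha> \<inter> {n<..2*n}) = J" using IJ by (force simp: image_image)
  ultimately show "det (submatrix A I J) > 0"
    using pos[OF \<alpha>] bracket_eq_det_submatrix[OF A \<alpha>] by simp
qed

section \<open>Boundedness of basic ratios\<close>

text \<open>Sorting the rows contributes one sign for each of \<open>a\<close>, \<open>b\<close>,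
  \<open>c\<close>, \<open>d\<close>, determined by \<open>\<Delta>\<close> alone. Each product in
  \<open>minor_three_term\<close> uses all four elements once, so the common sign drops out.\<close>

lemma minor_exchange:
  fixes M :: "nat \<Rightarrow> nat \<Rightarrow> 'a :: field"
  assumes \<Delta>: "finite \<Delta>" "card \<Delta> + 2 = n" and lt: "a < b" "b < c" "c < d"
    and disj: "{a, b, c, d} \<inter> \<Delta> = {}"
  defines "p x y \<equiv> minor M (sorted_list_of_set ({x, y} \<union> \<Delta>)) [0..<n]"
  assumes nz: "p a b \<noteq> 0"
  shows "p a c * p b d = p a b * p c d + p a d * p b c"
proof -
  define ds where "ds = sorted_list_of_set \<Delta>"
  define \<sigma> where "\<sigma> x = ((-1) ^ length (filter (\<lambda>d. d < x) ds) :: 'a)" for x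
  define D where "D x y = minor M (x # y # ds) [0..<n]" for x y
  have ds: "sorted ds" "set ds = \<Delta>" "distinct ds" "length ds + 2 = n"
    using \<Delta> by (auto simp: ds_def)
  have D: "D x y = \<sigma> x * \<sigma> y * p x y" if "x < y" "x \<notin> \<Delta>" "y \<notin> \<Delta>" for x y
  proof -
    have "sorted_list_of_set ({x, y} \<union> \<Delta>) = insort x (insort y ds)"
      using \<Delta> ds that by (intro sorted_distinct_set_unique) (auto simp: sorted_insort distinct_insort set_insort_key)
    moreover have "D x y = \<sigma> y * minor M ([x] @ insort y ds) [0..<n]"
      using minor_insort[of ds y "[0..<n]" "[x]" M] ds that by (simp add: D_def \<sigma>_def)
    \<comment> \<open>Since \<open>x < y\<close>, the inserted \<open>y\<close> does not add to the
      number of entries below \<open>x\<close>.\<close>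
    moreover have "minor M ([x] @ insort y ds) [0..<n] = \<sigma> x * minor M (insort x (insort y ds)) [0..<n]"
      using minor_insort[of "insort y ds" x "[0..<n]" "[]" M] ds that
      by (simp add: \<sigma>_def filter_insort_triv sorted_insort set_insort_key)
    ultimately show ?thesis by (simp add: p_def)
  qed
  have \<sigma>0: "\<sigma> x \<noteq> 0" for x by (simp add: \<sigma>_def)
  have "D a b \<noteq> 0" using nz D[of a b] lt disj \<sigma>0 by simp
  then have "D a b * D c d - D a c * D b d + D a d * D b c = 0"
    unfolding D_def by (intro minor_three_term ds)
  then have "(\<sigma> a * \<sigma> b * \<sigma> c * \<sigma> d) * (p a b * p c d - p a c * p b d + p a d * p b c) = 0"
    using D[of a b] D[of c d] D[of a c] D[of b d] D[of a d] D[of b c] lt disj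
    by (simp add: algebra_simps)
  then have "p a b * p c d - p a c * p b d + p a d * p b c = 0" using \<sigma>0 by simp
  then show ?thesis by (simp add: algebra_simps)
qed

text \<open>The sum side of the three-term relation has two positive terms, so each of them is at
  most the other side.\<close>

lemma bracket_exchange_le:
  assumes tp: "totally_positive n A" and \<Delta>: "\<Delta> \<subseteq> {1..2*n}" "card \<Delta> + 2 = n"
    and lt: "a \<ge> 1" "a < b" "b < c" "c < d" "d \<le> 2 * n" and disj: "{a, b, c, d} \<inter> \<Delta> = {}"
  defines "B x y \<equiv> bracket n ({x, y} \<union> \<Delta>) A"
  shows "B a d * B b c \<le> B a c * B b d" "B a b * B c d \<le> B a c * B b d"
proof -
  have A: "A \<in> carrier_mat n n" using tp by (simp add: totally_positive_def)
  have fin: "finite \<Delta>" using \<Delta> finite_subset by blast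
  have idx: "index_set n ({x, y} \<union> \<Delta>)" if "x < y" "x \<in> {a,b,c,d}" "y \<in> {a,b,c,d}" for x y
    using that lt disj \<Delta> fin by (auto simp: index_set_def card_insert_if)
  have pos: "B x y > 0" if "x < y" "x \<in> {a,b,c,d}" "y \<in> {a,b,c,d}" for x y
    unfolding B_def using bracket_pos[OF tp idx[OF that]] .
  have Bp: "B x y = minor (bar_entry n A) (sorted_list_of_set ({x, y} \<union> \<Delta>)) [0..<n]"
    if "x < y" "x \<in> {a,b,c,d}" "y \<in> {a,b,c,d}" for x y
    unfolding B_def using bracket_eq_minor[OF A idx[OF that]] .
  have "B a c * B b d = B a b * B c d + B a d * B b c"
    using minor_exchange[OF fin \<Delta>(2) lt(2-4) disj, of "bar_entry n A"]
      Bp[of a c] Bp[of b d] Bp[of a b] Bp[of c d] Bp[of a d] Bp[of b c] pos[of a b] lt by simp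
  moreover have "B a b * B c d > 0" "B a d * B b c > 0" using pos lt by simp_all
  ultimately show "B a d * B b c \<le> B a c * B b d" "B a b * B c d \<le> B a c * B b d" by linarith+
qed

lemma basic_exchange_le:
  assumes tp: "totally_positive n A" and \<Delta>: "\<Delta> \<subseteq> {1..2*n}" "card \<Delta> + 2 = n"
    and ij: "i \<in> {1..2*n}" "j \<in> {1..2*n}" "distinct [i, cyc_succ n i, j, cyc_succ n j]"
    and disj: "{i, cyc_succ n i, j, cyc_succ n j} \<inter> \<Delta> = {}"
  shows "bracket n ({i, cyc_succ n j} \<union> \<Delta>) A * bracket n ({cyc_succ n i, j} \<union> \<Delta>) A
    \<le> bracket n ({i, j} \<union> \<Delta>) A * bracket n ({cyc_succ n i, cyc_succ n j} \<union> \<Delta>) A"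
proof -
  note ex = bracket_exchange_le[OF tp \<Delta>]
  \<comment> \<open>If \<open>i\<close> or \<open>j\<close> is \<open>2 * n\<close>, its successor 1
    comes first in the order, and the numerator has the form \<open>B a b * B c d\<close>; otherwise
    it has the form \<open>B a d * B b c\<close>.\<close>
  consider "i = 2 * n" | "j = 2 * n" | "i < 2 * n" "j < 2 * n" "i < j" | "i < 2 * n" "j < 2 * n" "j < i"
    using ij by fastforce
  then show ?thesis
  proof cases
    case 1
    then show ?thesis using ex(2)[of 1 j "Suc j" "2 * n"] ij disj
      by (auto simp: cyc_succ_def insert_commute mult.commute split: if_splits)
  next
    case 2
    then show ?thesis using ex(2)[of 1 i "Suc i" "2 * n"] ij disj
      by (auto simp: cyc_succ_def insert_commute mult.commute split: if_splits)
  next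
    case 3
    then show ?thesis using ex(1)[of i "Suc i" j "Suc j"] ij disj by (auto simp: cyc_succ_def)
  next
    case 4
    then show ?thesis using ex(1)[of j "Suc j" i "Suc i"] ij disj
      by (auto simp: cyc_succ_def insert_commute mult.commute)
  qed
qed

text \<open>Logarithm of the value at \<open>A\<close>. It is additive on the free abelian group, so
  products and cancellation of formal quotients carry over to inequalities between brackets.\<close>

definition log_value :: "nat \<Rightarrow> real mat \<Rightarrow> formal_quotient \<Rightarrow> real" where
  "log_value n A q = (\<Sum>\<alpha>\<in>Pow {1..2*n}. of_int (poly_mapping.lookup q \<alpha>) * ln (bracket n \<alpha> A))"

lemma log_value_add: "log_value n A (q + r) = log_value n A q + log_value n A r"
  by (simp add: log_value_def lookup_add algebra_simps sum.distrib)

lemma log_value_formal_ratio: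
  assumes "index_set n \<alpha>1" "index_set n \<alpha>2" "index_set n \<beta>1" "index_set n \<beta>2"
  shows "log_value n A (formal_ratio \<alpha>1 \<alpha>2 \<beta>1 \<beta>2) =
    ln (bracket n \<alpha>1 A) + ln (bracket n \<alpha>2 A) - (ln (bracket n \<beta>1 A) + ln (bracket n \<beta>2 A))"
proof -
  have frag: "log_value n A (frag_of \<gamma>) = ln (bracket n \<gamma> A)" if "index_set n \<gamma>" for \<gamma>
  proof -
    have "log_value n A (frag_of \<gamma>) = (\<Sum>\<alpha>\<in>Pow {1..2*n}. if \<alpha> = \<gamma> then ln (bracket n \<gamma> A) else 0)"
      unfolding log_value_def by (intro sum.cong) (auto simp: lookup_single when_def)
    then show ?thesis using that by (simp add: index_set_def)
  qed
  have "log_value n A (q - r) = log_value n A q - log_value n A r" for q r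
    using log_value_add[of n A "q - r" r] by simp
  then show ?thesis using assms by (simp add: formal_ratio_def log_value_add frag)
qed

lemma formal_ratio_le_iff:
  assumes "totally_positive n A"
    and "index_set n \<alpha>1" "index_set n \<alpha>2" "index_set n \<beta>1" "index_set n \<beta>2"
  shows "log_value n A (formal_ratio \<alpha>1 \<alpha>2 \<beta>1 \<beta>2) \<le> 0 \<longleftrightarrow>
    bracket n \<alpha>1 A * bracket n \<alpha>2 A \<le> bracket n \<beta>1 A * bracket n \<beta>2 A"
proof -
  have pos: "bracket n \<alpha>1 A > 0" "bracket n \<alpha>2 A > 0" "bracket n \<beta>1 A > 0" "bracket n \<beta>2 A > 0"
    using assms bracket_pos by auto
  have "log_value n A (formal_ratio \<alpha>1 \<alpha>2 \<beta>1 \<beta>2) =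
     ln (bracket n \<alpha>1 A * bracket n \<alpha>2 A) - ln (bracket n \<beta>1 A * bracket n \<beta>2 A)"
    using pos by (simp add: log_value_formal_ratio assms ln_mult_pos)
  then show ?thesis using pos by simp
qed

lemma product_bounded_by_1:
  assumes prod: "product_of_basic_ratios n (formal_ratio \<alpha>1 \<alpha>2 \<beta>1 \<beta>2)"
    and idx: "index_set n \<alpha>1" "index_set n \<alpha>2" "index_set n \<beta>1" "index_set n \<beta>2"
  shows "ratio_bounded_by n 1 \<alpha>1 \<alpha>2 \<beta>1 \<beta>2"
  unfolding ratio_bounded_by_def
proof (intro conjI allI impI)
  fix A assume tp: "totally_positive n A"
  have basic: "log_value n A b \<le> 0" if b_basic: "basic_ratio n b" for b
  proof -
    obtain i j \<Delta> where b: "i \<in> {1..2*n}" "j \<in> {1..2*n}" "\<Delta> \<subseteq> {1..2*n}" "card \<Delta> + 2 = n"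
        "distinct [i, cyc_succ n i, j, cyc_succ n j]"
        "{i, cyc_succ n i, j, cyc_succ n j} \<inter> \<Delta> = {}"
        "b = formal_ratio ({i, cyc_succ n j} \<union> \<Delta>) ({cyc_succ n i, j} \<union> \<Delta>)
                         ({i, j} \<union> \<Delta>) ({cyc_succ n i, cyc_succ n j} \<union> \<Delta>)"
      using b_basic unfolding basic_ratio_def by blast
    have fin: "finite \<Delta>" using b(3) finite_subset by blast
    have range: "cyc_succ n k \<in> {1..2*n}" if "k \<in> {1..2*n}" for k
      using that by (auto simp: cyc_succ_def)
    have pair: "index_set n ({x, y} \<union> \<Delta>)"
      if "x \<in> {1..2*n}" "y \<in> {1..2*n}" "x \<noteq> y" "x \<notin> \<Delta>" "y \<notin> \<Delta>" for x y
      using that b(3,4) fin by (auto simp: index_set_def card_insert_if)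
    have "index_set n ({i, cyc_succ n j} \<union> \<Delta>)" "index_set n ({cyc_succ n i, j} \<union> \<Delta>)"
      "index_set n ({i, j} \<union> \<Delta>)" "index_set n ({cyc_succ n i, cyc_succ n j} \<union> \<Delta>)"
      by (rule pair; use b(1,2,5,6) range in simp)+
    then show ?thesis
      unfolding b(7) using basic_exchange_le[OF tp b(3,4,1,2,5,6)] by (simp only: formal_ratio_le_iff[OF tp])
  qed
  obtain qs where qs: "\<forall>b\<in>set qs. basic_ratio n b" "formal_ratio \<alpha>1 \<alpha>2 \<beta>1 \<beta>2 = sum_list qs"
    using prod unfolding product_of_basic_ratios_def by blast
  have "log_value n A (sum_list qs) \<le> 0" using qs(1)
  proof (induction qs)
    case (Cons b qs)
    then show ?case using basic[of b] by (simp add: log_value_add)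
  qed (simp add: log_value_def)
  then show "bracket n \<alpha>1 A * bracket n \<alpha>2 A \<le> 1 * (bracket n \<beta>1 A * bracket n \<beta>2 A)"
    using formal_ratio_le_iff[OF tp idx] qs(2) by simp
qed simp

section \<open>Totally positive matrices from Vandermonde matrices\<close>

text \<open>Column operations replace the monomials by the Newton polynomials, making the matrix triangular.\<close>

lemma det_vandermonde_rows:
  fixes w x :: "nat \<Rightarrow> 'a :: idom"
  shows "det (mat m m (\<lambda>(i, j). w i * x i ^ j)) = (\<Prod>j<m. w j * (\<Prod>i<j. x j - x i))"
proof -
  define N where "N j = (\<Prod>i<j. [:- x i, 1:])" for j
  define C where "C = mat m m (\<lambda>(k, j). coeff (N j) k)"
  define V where "V = mat m m (\<lambda>(i, j). w i * x i ^ j)"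
  have N: "degree (N j) = j \<and> coeff (N j) j = 1" for j
  proof (induction j)
    case (Suc j)
    have NS: "N (Suc j) = N j * [:- x j, 1:]" by (simp add: N_def)
    have "N j \<noteq> 0" using Suc by auto
    then have "degree (N (Suc j)) = Suc j" unfolding NS using Suc by (subst degree_mult_eq) auto
    moreover have "coeff (N (Suc j)) (Suc j) = 1" unfolding NS using Suc by (simp add: coeff_eq_0)
    ultimately show ?case by blast
  qed (simp add: N_def)
  have polyN: "poly (N j) t = (\<Prod>i<j. t - x i)" for j t by (simp add: N_def poly_prod)
  have "det C = prod_list (diag_mat C)"
    by (rule det_upper_triangular[of _ m]) (auto simp: upper_triangular_def C_def coeff_eq_0 N)
  also have "diag_mat C = map (\<lambda>i. 1) [0..<m]" unfolding diag_mat_def by (auto simp: C_def N)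
  finally have C1: "det C = 1" by (simp add: map_replicate_const)
  have "V * C = mat m m (\<lambda>(i, j). w i * poly (N j) (x i))"
  proof (rule eq_matI)
    fix i j assume "i < dim_row (mat m m (\<lambda>(i, j). w i * poly (N j) (x i)))"
      "j < dim_col (mat m m (\<lambda>(i, j). w i * poly (N j) (x i)))"
    then have ij: "i < m" "j < m" by auto
    have "(V * C) $$ (i, j) = (\<Sum>k<m. w i * (coeff (N j) k * x i ^ k))"
      using ij by (simp add: V_def C_def scalar_prod_def atLeast0LessThan mult_ac)
    also have "\<dots> = (\<Sum>k\<le>j. w i * (coeff (N j) k * x i ^ k))"
      using ij by (intro sum.mono_neutral_right) (auto simp: coeff_eq_0 N)
    finally show "(V * C) $$ (i, j) = mat m m (\<lambda>(i, j). w i * poly (N j) (x i)) $$ (i, j)"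
      using ij by (simp add: poly_altdef N sum_distrib_left)
  qed (auto simp: V_def C_def)
  then have "det V = det (mat m m (\<lambda>(i, j). w i * poly (N j) (x i)))"
    using C1 det_mult[of V m C] by (simp add: V_def C_def)
  \<comment> \<open>\<open>N j\<close> vanishes at \<open>x i\<close> for \<open>i < j\<close>, so
    only entries on and below the diagonal remain.\<close>
  also have "\<dots> = prod_list (diag_mat (mat m m (\<lambda>(i, j). w i * poly (N j) (x i))))"
    by (rule det_lower_triangular[of m]) (auto simp: polyN)
  also have "diag_mat (mat m m (\<lambda>(i, j). w i * poly (N j) (x i))) = map (\<lambda>j. w j * (\<Prod>i<j. x j - x i)) [0..<m]"
    unfolding diag_mat_def by (auto simp: polyN)
  also have "prod_list \<dots> = (\<Prod>j<m. w j * (\<Prod>i<j. x j - x i))"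
    by (simp add: prod.distinct_set_conv_list[symmetric] atLeast0LessThan)
  finally show ?thesis by (simp add: V_def)
qed

text \<open>Maximal minor of the matrix with rows \<open>w i * (1, x i, x i ^ 2, ...)\<close> in
  product form. The weights serve to rescale rows, the nodes to let rows collide.\<close>

definition vandermonde :: "(nat \<Rightarrow> real) \<Rightarrow> (nat \<Rightarrow> real) \<Rightarrow> nat set \<Rightarrow> real" where
  "vandermonde w x \<alpha> = (\<Prod>j\<in>\<alpha>. w j * (\<Prod>i\<in>{i\<in>\<alpha>. i < j}. x j - x i))"

lemma minor_vandermonde:
  assumes "finite \<alpha>" "card \<alpha> = n"
  shows "minor (\<lambda>i k. w i * x i ^ k) (sorted_list_of_set \<alpha>) [0..<n] = vandermonde w x \<alpha>"
proof -
  let ?xs = "sorted_list_of_set \<alpha>"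
  have bij: "bij_betw ((!) ?xs) {..<n} \<alpha>" using assms by (intro bij_betw_nth) auto
  have strict: "sorted_wrt (<) ?xs" by simp
  have less: "?xs ! i < ?xs ! j \<longleftrightarrow> i < j" if "i < n" "j < n" for i j
    using that assms sorted_wrt_nth_less[OF strict, of i j] sorted_wrt_nth_less[OF strict, of j i]
    by (cases i j rule: linorder_cases) auto
  have "minor (\<lambda>i k. w i * x i ^ k) ?xs [0..<n] = det (mat n n (\<lambda>(i, j). w (?xs ! i) * x (?xs ! i) ^ j))"
    using assms by (simp add: minor_upt)
  also have "\<dots> = (\<Prod>j<n. w (?xs ! j) * (\<Prod>i<j. x (?xs ! j) - x (?xs ! i)))"
    by (rule det_vandermonde_rows)
  also have "\<dots> = (\<Prod>j<n. w (?xs ! j) * (\<Prod>i\<in>{i\<in>\<alpha>. i < ?xs ! j}. x (?xs ! j) - x i))"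
  proof (rule prod.cong[OF refl], rule arg_cong[of _ _ "(*) _"])
    fix j assume j: "j \<in> {..<n}"
    have img: "(!) ?xs ` {..<n} = \<alpha>" using bij by (simp add: bij_betw_def)
    have "(!) ?xs ` {..<j} = {x \<in> (!) ?xs ` {..<n}. x < ?xs ! j}"
      using j less[OF _ lessThan_iff[THEN iffD1, OF j]] by force
    then have "(!) ?xs ` {..<j} = {i\<in>\<alpha>. i < ?xs ! j}" by (simp only: img)
    moreover have "inj_on ((!) ?xs) {..<j}" using bij j by (auto simp: bij_betw_def intro: inj_on_subset)
    ultimately have "bij_betw ((!) ?xs) {..<j} {i\<in>\<alpha>. i < ?xs ! j}" by (simp add: bij_betw_def)
    then show "(\<Prod>i<j. x (?xs ! j) - x (?xs ! i)) = (\<Prod>i\<in>{i\<in>\<alpha>. i < ?xs ! j}. x (?xs ! j) - x i)"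
      by (rule prod.reindex_bij_betw)
  qed
  also have "\<dots> = vandermonde w x \<alpha>"
    unfolding vandermonde_def using bij by (rule prod.reindex_bij_betw)
  finally show ?thesis .
qed

text \<open>The lower block \<open>L\<close> of \<open>M\<close> is invertible. Right multiplication
  by its inverse times \<open>lower_block n\<close> gives \<open>M\<close> the shape of
  \<open>bar_mat n A\<close> and scales all maximal minors by the single constant
  \<open>det G\<close>.\<close>

lemma exists_totally_positive:
  fixes M :: "nat \<Rightarrow> nat \<Rightarrow> real"
  assumes pos: "\<And>\<alpha>. index_set n \<alpha> \<Longrightarrow> minor M (sorted_list_of_set \<alpha>) [0..<n] > 0"
  obtains A c where "totally_positive n A" "c > 0"
    "\<And>\<alpha>. index_set n \<alpha> \<Longrightarrow> bracket n \<alpha> A = minor M (sorted_list_of_set \<alpha>) [0..<n] * c"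
proof -
  define L where "L = mat n n (\<lambda>(i, j). M (Suc n + i) j)"
  have L: "L \<in> carrier_mat n n" by (simp add: L_def)
  let ?low = "{Suc n..<Suc (2 * n)}"
  have low: "index_set n ?low" by (auto simp: index_set_def)
  have low_list: "sorted_list_of_set ?low = [Suc n..<Suc (2 * n)]" by (rule sorted_list_of_set_range)
  have "mat n n (\<lambda>(i, j). M ([Suc n..<Suc (2 * n)] ! i) j) = L"
    unfolding L_def by (intro cong_mat) (auto simp del: upt_Suc)
  then have "minor M (sorted_list_of_set ?low) [0..<n] = det L"
    unfolding low_list by (subst minor_upt) (auto simp del: upt_Suc)
  then have "det L > 0" using pos[OF low] by simp
  then obtain Li where Li: "Li \<in> carrier_mat n n" "L * Li = 1\<^sub>m n"
    using det_nonzero_inverse[OF L] by (metis less_irrefl)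
  define G where "G = Li * lower_block n"
  have lower: "lower_block n \<in> carrier_mat n n" by (simp add: lower_block_def)
  have G: "G \<in> carrier_mat n n" using Li lower by (simp add: G_def)
  have "L * G = (L * Li) * lower_block n" unfolding G_def using L Li(1) lower by (simp add: assoc_mult_mat[of _ n n])
  then have LG: "L * G = lower_block n" using Li(2) lower by simp
  define A where "A = mat n n (\<lambda>(i, j). M (Suc i) j) * G"
  have A: "A \<in> carrier_mat n n" using G by (auto simp: A_def intro!: mult_carrier_mat[of _ n n])
  have entry: "bar_entry n A i j = (\<Sum>k<n. M i k * G $$ (k, j))" if "i \<in> {1..2*n}" "j < n" for i j
  proof (cases "i \<le> n")
    case True
    then show ?thesis using that G by (simp add: bar_entry_def A_def scalar_prod_def atLeast0LessThan)
  next
    case False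
    define r where "r = i - Suc n"
    have r: "i = Suc n + r" "r < n" using False that by (auto simp: r_def)
    have "(L * G) $$ (r, j) = (\<Sum>k<n. M i k * G $$ (k, j))"
      using r that G by (simp add: L_def scalar_prod_def atLeast0LessThan)
    moreover have "lower_block n $$ (r, j) = bar_entry n A i j"
      using r that by (auto simp: lower_block_def bar_entry_def)
    ultimately show ?thesis by (simp add: LG)
  qed
  have br: "bracket n \<alpha> A = minor M (sorted_list_of_set \<alpha>) [0..<n] * det G" if "index_set n \<alpha>" for \<alpha>
  proof -
    have \<alpha>: "\<alpha> \<subseteq> {1..2*n}" "finite \<alpha>" "card \<alpha> = n" using that finite_subset by (auto simp: index_set_def)
    have "bracket n \<alpha> A = minor (\<lambda>i j. \<Sum>k<n. M i k * G $$ (k, j)) (sorted_list_of_set \<alpha>) [0..<n]"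
      unfolding bracket_eq_minor[OF A that] using \<alpha> by (intro minor_cong entry) auto
    also have "\<dots> = minor M (sorted_list_of_set \<alpha>) [0..<n] * det G"
      using \<alpha> G by (intro minor_mult) auto
    finally show ?thesis .
  qed
  have empty: "?low \<inter> {1..n} = {}" by auto
  have "card ({..<n} - (\<lambda>k. 2 * n - k) ` (?low \<inter> {n<..2*n})) = 0"
    using card_complement_columns[OF low] empty by simp
  then have cols: "{..<n} - (\<lambda>k. 2 * n - k) ` (?low \<inter> {n<..2*n}) = {}"
    by (metis card_0_eq finite_Diff finite_lessThan)
  \<comment> \<open>The sign of \<open>det G\<close> is read off from \<open>?low\<close>: its
    bracket is the empty minor 1, and its minor in \<open>M\<close> is positive.\<close>
  have "bracket n ?low A = det (submatrix A {} {})"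
    unfolding bracket_eq_det_submatrix[OF A low] empty cols by simp
  then have "bracket n ?low A = 1" by (simp add: submatrix_def)
  then have "0 < minor M (sorted_list_of_set ?low) [0..<n] * det G" using br[OF low] by simp
  then have "det G > 0" using pos[OF low] by (rule zero_less_mult_pos)
  moreover from this have "totally_positive n A"
    using br pos by (intro totally_positiveI[OF A]) simp
  ultimately show ?thesis using that br by blast
qed

section \<open>Necessity of the interval condition\<close>

lemma vandermonde_pos:
  assumes "\<alpha> \<subseteq> {1..2*n}" "\<And>i. i \<in> {1..2*n} \<Longrightarrow> w i > 0"
    and "\<And>i j. i \<in> {1..2*n} \<Longrightarrow> j \<in> {1..2*n} \<Longrightarrow> i < j \<Longrightarrow> x i < x j"
  shows "vandermonde w x \<alpha> > 0"
  unfolding vandermonde_def using assms by (intro prod_pos mult_pos_pos) (auto intro!: prod_pos simp: subset_iff)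

text \<open>The constant \<open>c\<close> of \<open>exists_totally_positive\<close> occurs squared
  on both sides and cancels, so a bound on brackets passes to Vandermonde minors.\<close>

lemma bounded_vandermonde:
  assumes bd: "ratio_bounded_by n k \<alpha>1 \<alpha>2 \<beta>1 \<beta>2"
    and idx: "index_set n \<alpha>1" "index_set n \<alpha>2" "index_set n \<beta>1" "index_set n \<beta>2"
    and w: "\<And>i. i \<in> {1..2*n} \<Longrightarrow> w i > 0"
    and x: "\<And>i j. i \<in> {1..2*n} \<Longrightarrow> j \<in> {1..2*n} \<Longrightarrow> i < j \<Longrightarrow> x i < x j"
  shows "vandermonde w x \<alpha>1 * vandermonde w x \<alpha>2 \<le> k * (vandermonde w x \<beta>1 * vandermonde w x \<beta>2)"
proof -
  have m: "minor (\<lambda>i k. w i * x i ^ k) (sorted_list_of_set \<alpha>) [0..<n] = vandermonde w x \<alpha>"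
    if "index_set n \<alpha>" for \<alpha>
    using that finite_subset by (intro minor_vandermonde) (auto simp: index_set_def)
  have "minor (\<lambda>i k. w i * x i ^ k) (sorted_list_of_set \<alpha>) [0..<n] > 0" if "index_set n \<alpha>" for \<alpha>
    unfolding m[OF that] by (rule vandermonde_pos[of _ n]) (use that w x in \<open>auto simp: index_set_def\<close>)
  then obtain A c where A: "totally_positive n A" "c > 0"
    "\<And>\<alpha>. index_set n \<alpha> \<Longrightarrow> bracket n \<alpha> A = minor (\<lambda>i k. w i * x i ^ k) (sorted_list_of_set \<alpha>) [0..<n] * c"
    using exists_totally_positive by blast
  have "bracket n \<alpha>1 A * bracket n \<alpha>2 A \<le> k * (bracket n \<beta>1 A * bracket n \<beta>2 A)"
    using bd A(1) by (simp add: ratio_bounded_by_def)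
  then have "(c * c) * (vandermonde w x \<alpha>1 * vandermonde w x \<alpha>2)
      \<le> (c * c) * (k * (vandermonde w x \<beta>1 * vandermonde w x \<beta>2))"
    by (simp add: A(3) idx m mult_ac)
  then show ?thesis using A(2) by simp
qed

text \<open>Otherwise division by \<open>e ^ a\<close> would bound the positive constant
  \<open>C\<close> by \<open>K * e\<close>, which tends to 0 with \<open>e\<close>.\<close>

lemma exponent_le_if_power_le:
  fixes C K :: real
  assumes "C > 0" and le: "\<And>e. 0 < e \<Longrightarrow> e < 1 \<Longrightarrow> C * e ^ a \<le> K * e ^ b"
  shows "b \<le> a"
proof (rule ccontr)
  assume "\<not> b \<le> a"
  then obtain d where d: "b = a + Suc d" by (metis add_Suc_right less_imp_Suc_add not_le)
  have *: "C \<le> K * e" if "0 < e" "e < 1" for e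
  proof -
    have "e ^ a * C \<le> e ^ a * (K * e ^ Suc d)" using le[OF that] by (simp add: d power_add mult_ac)
    then have "C \<le> K * e * e ^ d" using that by (simp add: mult_ac)
    \<comment> \<open>The sign of \<open>K\<close> follows from the inequality itself; it allows
      \<open>e ^ d\<close> to be replaced by 1.\<close>
    moreover from this have "K * e > 0"
      using assms(1) that by (metis less_le_trans zero_less_mult_pos2 zero_less_power)
    then have "K * e * e ^ d \<le> K * e * 1" using that by (intro mult_left_mono power_le_one) auto
    ultimately show ?thesis by simp
  qed
  have K: "K > 0" using *[of "1/2"] assms(1) by simp
  \<comment> \<open>Chosen so that \<open>K * e\<close> is at most \<open>C / 2\<close> while
    \<open>e\<close> stays below 1.\<close>
  define e where "e = min (1/2) (C / (2 * K))"
  have "C \<le> K * e" using K assms(1) by (intro *) (auto simp: e_def)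
  also have "\<dots> \<le> K * (C / (2 * K))" using K by (intro mult_left_mono) (auto simp: e_def)
  also have "\<dots> = C / 2" using K by simp
  finally show False using assms(1) by simp
qed

text \<open>Multiplying the rows in \<open>T\<close> by \<open>e\<close> scales the minor of
  \<open>\<gamma>\<close> by \<open>e ^ card (\<gamma> \<inter> T)\<close>; comparing orders as
  \<open>e\<close> tends to 0 gives the inequality.\<close>

lemma bounded_scale_rows:
  assumes bd: "ratio_bounded_by n k \<alpha>1 \<alpha>2 \<beta>1 \<beta>2"
    and idx: "index_set n \<alpha>1" "index_set n \<alpha>2" "index_set n \<beta>1" "index_set n \<beta>2"
  shows "card (\<beta>1 \<inter> T) + card (\<beta>2 \<inter> T) \<le> card (\<alpha>1 \<inter> T) + card (\<alpha>2 \<inter> T)"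
proof -
  define V where "V = vandermonde (\<lambda>_. 1) real"
  have V: "vandermonde (\<lambda>i. if i \<in> T then e else 1) real \<gamma> = e ^ card (\<gamma> \<inter> T) * V \<gamma>"
    if "index_set n \<gamma>" for \<gamma> and e :: real
  proof -
    have fin: "finite \<gamma>" using that finite_subset by (auto simp: index_set_def)
    have "(\<Prod>i\<in>\<gamma>. if i \<in> T then e else 1) = (\<Prod>i\<in>\<gamma> \<inter> T. e)"
      using prod.inter_restrict[OF fin, of "\<lambda>_. e" T] by simp
    then show ?thesis by (simp add: vandermonde_def V_def prod.distrib)
  qed
  have pos: "V \<gamma> > 0" if "index_set n \<gamma>" for \<gamma>
    unfolding V_def by (rule vandermonde_pos[of _ n]) (use that in \<open>auto simp: index_set_def\<close>)
  have "V \<alpha>1 * V \<alpha>2 * e ^ (card (\<alpha>1 \<inter> T) + card (\<alpha>2 \<inter> T))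
     \<le> (k * (V \<beta>1 * V \<beta>2)) * e ^ (card (\<beta>1 \<inter> T) + card (\<beta>2 \<inter> T))" if "0 < e" "e < 1" for e :: real
    using bounded_vandermonde[OF bd idx, of "\<lambda>i. if i \<in> T then e else 1" real] that
    by (simp add: V idx power_add mult_ac)
  then show ?thesis
    by (rule exponent_le_if_power_le[rotated]) (use pos idx in auto)
qed

text \<open>On the complement of \<open>T\<close> the counts are \<open>n\<close> minus those on
  \<open>T\<close>, so \<open>bounded_scale_rows\<close> for the two sets gives both
  inequalities.\<close>

lemma bounded_imp_equal_counts:
  assumes bd: "ratio_bounded_by n k \<alpha>1 \<alpha>2 \<beta>1 \<beta>2"
    and idx: "index_set n \<alpha>1" "index_set n \<alpha>2" "index_set n \<beta>1" "index_set n \<beta>2"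
  shows "card (\<alpha>1 \<inter> T) + card (\<alpha>2 \<inter> T) = card (\<beta>1 \<inter> T) + card (\<beta>2 \<inter> T)"
proof -
  have "card (\<gamma> \<inter> T) + card (\<gamma> \<inter> - T) = n" if "index_set n \<gamma>" for \<gamma>
  proof -
    have "finite \<gamma>" using that finite_subset by (auto simp: index_set_def)
    then have "card (\<gamma> \<inter> T) + card (\<gamma> \<inter> - T) = card ((\<gamma> \<inter> T) \<union> (\<gamma> \<inter> - T))"
      by (subst card_Un_disjoint) auto
    also have "(\<gamma> \<inter> T) \<union> (\<gamma> \<inter> - T) = \<gamma>" by blast
    finally show ?thesis using that by (simp add: index_set_def)
  qed
  from this[OF idx(1)] this[OF idx(2)] this[OF idx(3)] this[OF idx(4)]
    bounded_scale_rows[OF bd idx, of T] bounded_scale_rows[OF bd idx, of "- T"]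
  show ?thesis by linarith
qed

text \<open>The sum counts pairs, so it is \<open>card X\<close> choose 2; the doubled form avoids
  division. A new maximum forms one pair with each older element.\<close>

lemma card_ordered_pairs:
  fixes X :: "nat set"
  assumes "finite X"
  shows "2 * (\<Sum>j\<in>X. card {i\<in>X. i < j}) + card X = card X ^ 2"
  using assms
proof (induction X rule: finite_linorder_max_induct)
  case (insert b X)
  have "{i \<in> insert b X. i < j} = {i\<in>X. i < j}" if "j \<in> X" for j
    using insert.hyps(2) that by auto
  moreover have "{i \<in> insert b X. i < b} = X" using insert.hyps(2) by auto
  moreover have "b \<notin> X" using insert.hyps(2) by auto
  ultimately have "(\<Sum>j\<in>insert b X. card {i \<in> insert b X. i < j}) = card X + (\<Sum>j\<in>X. card {i\<in>X. i < j})"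
    using insert.hyps(1) by simp
  then show ?case using insert \<open>b \<notin> X\<close> by (simp add: power2_eq_square)
qed simp

text \<open>
  Letting the nodes of the interval \<open>{a..b}\<close> collide at rate \<open>e\<close> makes a Vandermonde minor vanish
  to the order of the number of pairs of its rows taken from the interval.
\<close>

lemma bounded_imp_pairs_le:
  fixes a b :: nat
  assumes bd: "ratio_bounded_by n k \<alpha>1 \<alpha>2 \<beta>1 \<beta>2"
    and idx: "index_set n \<alpha>1" "index_set n \<alpha>2" "index_set n \<beta>1" "index_set n \<beta>2"
  defines "N (\<gamma> :: nat set) \<equiv> \<Sum>j\<in>\<gamma> \<inter> {a..b}. card {i\<in>\<gamma> \<inter> {a..b}. i < j}"
  assumes ab: "a \<ge> 1"
  shows "N \<beta>1 + N \<beta>2 \<le> N \<alpha>1 + N \<alpha>2"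
proof -
  define L where "L = {a..b}"
  define x where "x e j = (if j \<in> L then real a + e * (real j - real a) else real j)" for e j
  \<comment> \<open>Up to a factor between 1 and \<open>2 * n\<close>, the gap between two nodes is
    \<open>e\<close> if both lie in \<open>L\<close> and 1 otherwise.\<close>
  have diff: "\<exists>g. x e j - x e i = (if i \<in> L \<and> j \<in> L then e else 1) * g \<and> 1 \<le> g \<and> g \<le> 2 * real n"
    if e: "0 < e" "e < 1" and ij: "i \<in> {1..2*n}" "j \<in> {1..2*n}" "i < j" for e i j
  proof -
    have j2: "real j \<le> 2 * real n" "1 \<le> real i" "real i + 1 \<le> real j" using ij by auto
    consider "i \<in> L" "j \<in> L" | "i \<notin> L" "j \<notin> L" | "i \<in> L" "j \<notin> L" | "i \<notin> L" "j \<in> L" by blast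
    then show ?thesis
    proof cases
      case 1
      then show ?thesis using j2 by (intro exI[of _ "real j - real i"]) (auto simp: x_def algebra_simps)
    next
      case 2
      then show ?thesis using j2 by (intro exI[of _ "real j - real i"]) (auto simp: x_def)
    next
      case 3
      \<comment> \<open>The contraction moves a node of \<open>L\<close> left, to a place between
        \<open>a\<close> and its old one, so it stays at distance at least 1 from every node outside
        \<open>L\<close>.\<close>
      have "e * (real i - real a) \<le> 1 * (real i - real a)" "0 \<le> e * (real i - real a)"
        using e 3 by (intro mult_right_mono mult_nonneg_nonneg; simp add: L_def)+
      moreover have "1 \<le> real a" using ab by simp
      ultimately show ?thesis using 3 j2 by (intro exI[of _ "x e j - x e i"]) (auto simp: x_def)
    next
      case 4
      have "e * (real j - real a) \<le> 1 * (real j - real a)" "0 \<le> e * (real j - real a)"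
        using e 4 by (intro mult_right_mono mult_nonneg_nonneg; simp add: L_def)+
      moreover have "real i + 1 \<le> real a" using 4 ij by (simp add: L_def)
      ultimately show ?thesis using 4 j2 by (intro exI[of _ "x e j - x e i"]) (auto simp: x_def)
    qed
  qed
  define K where "K \<gamma> = (\<Prod>j\<in>\<gamma>. \<Prod>i\<in>{i\<in>\<gamma>. i < j}. 2 * real n)" for \<gamma> :: "nat set"
  define W where "W e \<gamma> = vandermonde (\<lambda>_. 1) (x e) \<gamma>" for e \<gamma>
  \<comment> \<open>The gap estimates are multiplied over all pairs of rows; exactly the
    \<open>N \<gamma>\<close> pairs inside the interval contribute a factor
    \<open>e\<close>.\<close>
  have W: "e ^ N \<gamma> \<le> W e \<gamma>" "W e \<gamma> \<le> K \<gamma> * e ^ N \<gamma>" "K \<gamma> \<ge> 0"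
    if \<gamma>: "index_set n \<gamma>" and e: "0 < e" "e < 1" for e \<gamma>
  proof -
    have \<gamma>': "\<gamma> \<subseteq> {1..2*n}" "finite \<gamma>" using \<gamma> finite_subset by (auto simp: index_set_def)
    define E where "E i j = (if i \<in> L \<and> j \<in> L then e else 1)" for i j
    have E0: "E i j > 0" for i j using e by (simp add: E_def)
    have bounds: "E i j \<le> x e j - x e i" "x e j - x e i \<le> 2 * real n * E i j"
      if ij: "i \<in> \<gamma>" "j \<in> \<gamma>" "i < j" for i j
    proof -
      have "i \<in> {1..2*n}" "j \<in> {1..2*n}" using ij \<gamma>' by auto
      from diff[OF e this ij(3)] obtain g where g: "x e j - x e i = E i j * g" "1 \<le> g" "g \<le> 2 * real n"
        unfolding E_def by blast
      show "E i j \<le> x e j - x e i" using g(1,2) E0[of i j] by simp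
      show "x e j - x e i \<le> 2 * real n * E i j" using g(1,3) E0[of i j] by (simp add: mult.commute)
    qed
    have prodE: "(\<Prod>j\<in>\<gamma>. \<Prod>i\<in>{i\<in>\<gamma>. i < j}. E i j) = e ^ N \<gamma>"
    proof -
      have "(\<Prod>i\<in>{i\<in>\<gamma>. i < j}. E i j) = (if j \<in> L then e ^ card {i\<in>\<gamma> \<inter> L. i < j} else 1)" for j
      proof (cases "j \<in> L")
        case True
        have "(\<Prod>i\<in>{i\<in>\<gamma>. i < j}. E i j) = (\<Prod>i\<in>{i\<in>\<gamma>. i < j} \<inter> L. e)"
          using True \<gamma>'(2) prod.inter_restrict[of "{i\<in>\<gamma>. i < j}" "\<lambda>_. e" L] by (simp add: E_def)
        also have "{i\<in>\<gamma>. i < j} \<inter> L = {i\<in>\<gamma> \<inter> L. i < j}" by blast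
        finally show ?thesis using True by simp
      qed (simp add: E_def)
      then have "(\<Prod>j\<in>\<gamma>. \<Prod>i\<in>{i\<in>\<gamma>. i < j}. E i j) = (\<Prod>j\<in>\<gamma> \<inter> L. e ^ card {i\<in>\<gamma> \<inter> L. i < j})"
        by (simp only: prod.inter_restrict[OF \<gamma>'(2)])
      then show ?thesis by (simp add: N_def power_sum flip: L_def)
    qed
    have We: "W e \<gamma> = (\<Prod>j\<in>\<gamma>. \<Prod>i\<in>{i\<in>\<gamma>. i < j}. x e j - x e i)"
      by (simp add: W_def vandermonde_def)
    show "e ^ N \<gamma> \<le> W e \<gamma>"
      unfolding prodE[symmetric] We using bounds(1)
      by (intro prod_mono conjI prod_nonneg less_imp_le[OF E0]) auto
    have "W e \<gamma> \<le> (\<Prod>j\<in>\<gamma>. \<Prod>i\<in>{i\<in>\<gamma>. i < j}. 2 * real n * E i j)"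
    proof -
      have "0 \<le> x e j - x e i" if "i \<in> \<gamma>" "j \<in> \<gamma>" "i < j" for i j
        using bounds(1)[OF that] E0[of i j] by linarith
      then show ?thesis unfolding We using bounds(2) by (intro prod_mono conjI prod_nonneg) auto
    qed
    then show "W e \<gamma> \<le> K \<gamma> * e ^ N \<gamma>"
      by (simp only: prod.distrib K_def prodE)
    show "K \<gamma> \<ge> 0" unfolding K_def by (intro prod_nonneg) auto
  qed
  have k: "k > 0" using bd by (simp add: ratio_bounded_by_def)
  \<comment> \<open>The lower bounds for \<alpha> and the upper bounds for \<beta> leave an
    inequality between powers of \<open>e\<close>, from which the exponents are compared.\<close>
  have "1 * e ^ (N \<alpha>1 + N \<alpha>2) \<le> (k * (K \<beta>1 * K \<beta>2)) * e ^ (N \<beta>1 + N \<beta>2)"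
    if e: "0 < e" "e < 1" for e
  proof -
    have incr: "x e i < x e j" if ij: "i \<in> {1..2*n}" "j \<in> {1..2*n}" "i < j" for i j
    proof -
      obtain g where "x e j - x e i = (if i \<in> L \<and> j \<in> L then e else 1) * g" "1 \<le> g"
        using diff[OF e ij] by blast
      then have "x e j - x e i > 0" using e by simp
      then show ?thesis by simp
    qed
    note W = W[OF _ e]
    have pos: "0 \<le> W e \<gamma>" if "index_set n \<gamma>" for \<gamma>
      by (rule order_trans[OF _ W(1)[OF that]]) (use e in simp)
    have "e ^ N \<alpha>1 * e ^ N \<alpha>2 \<le> W e \<alpha>1 * W e \<alpha>2"
      using e by (intro mult_mono W(1) idx pos zero_le_power) simp
    also have "\<dots> \<le> k * (W e \<beta>1 * W e \<beta>2)"
      unfolding W_def by (rule bounded_vandermonde[OF bd idx]) (use incr in auto)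
    also have "\<dots> \<le> k * ((K \<beta>1 * e ^ N \<beta>1) * (K \<beta>2 * e ^ N \<beta>2))"
      using e k by (intro mult_left_mono mult_mono W(2,3) idx pos mult_nonneg_nonneg zero_le_power) simp_all
    finally show ?thesis by (simp add: power_add mult_ac)
  qed
  then show ?thesis by (intro exponent_le_if_power_le[of 1 "N \<alpha>1 + N \<alpha>2" "k * (K \<beta>1 * K \<beta>2)" "N \<beta>1 + N \<beta>2"]) simp_all
qed

lemma max_le_iff_abs_diff_le:
  fixes a1 a2 b1 b2 :: nat
  assumes "a1 + a2 = b1 + b2"
  shows "max b1 b2 \<le> max a1 a2 \<longleftrightarrow> \<bar>int b1 - int b2\<bar> \<le> \<bar>int a1 - int a2\<bar>"
  using assms by (auto simp: max_def)

text \<open>The number of pairs is \<open>(c^2 - c) / 2\<close> and the counts have equal sums, so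
  \<open>bounded_imp_pairs_le\<close> compares sums of squares. For a fixed sum these determine the
  squared difference.\<close>

lemma bounded_imp_abs_diff_le:
  fixes a b :: nat
  assumes bd: "ratio_bounded_by n k \<alpha>1 \<alpha>2 \<beta>1 \<beta>2"
    and idx: "index_set n \<alpha>1" "index_set n \<alpha>2" "index_set n \<beta>1" "index_set n \<beta>2"
    and "a \<ge> 1"
  defines "c \<gamma> \<equiv> int (card (\<gamma> \<inter> {a..b}))"
  shows "\<bar>c \<beta>1 - c \<beta>2\<bar> \<le> \<bar>c \<alpha>1 - c \<alpha>2\<bar>"
proof -
  define N where "N \<gamma> = (\<Sum>j\<in>\<gamma> \<inter> {a..b}. card {i\<in>\<gamma> \<inter> {a..b}. i < j})" for \<gamma> :: "nat set"
  have "2 * N \<gamma> + card (\<gamma> \<inter> {a..b}) = card (\<gamma> \<inter> {a..b}) ^ 2" for \<gamma>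
    unfolding N_def by (rule card_ordered_pairs) simp
  then have N: "2 * int (N \<gamma>) = c \<gamma> ^ 2 - c \<gamma>" for \<gamma>
    unfolding c_def by (metis add_diff_cancel_right' of_nat_add of_nat_mult of_nat_numeral of_nat_power)
  have "N \<beta>1 + N \<beta>2 \<le> N \<alpha>1 + N \<alpha>2"
    unfolding N_def using bounded_imp_pairs_le[OF bd idx \<open>a \<ge> 1\<close>] .
  moreover have sum: "c \<alpha>1 + c \<alpha>2 = c \<beta>1 + c \<beta>2"
    using bounded_imp_equal_counts[OF bd idx, of "{a..b}"] by (simp add: c_def flip: of_nat_add)
  ultimately have "c \<beta>1 ^ 2 + c \<beta>2 ^ 2 \<le> c \<alpha>1 ^ 2 + c \<alpha>2 ^ 2"
    using N[of \<alpha>1] N[of \<alpha>2] N[of \<beta>1] N[of \<beta>2] by linarith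
  moreover have "(u - v) ^ 2 = 2 * (u ^ 2 + v ^ 2) - (u + v) ^ 2" for u v :: int
    by (simp add: power2_eq_square algebra_simps)
  ultimately have "(c \<beta>1 - c \<beta>2) ^ 2 \<le> (c \<alpha>1 - c \<alpha>2) ^ 2" using sum by simp
  then show ?thesis by (simp add: abs_le_square_iff)
qed

section \<open>The counting conditions: ST0, interval maxima and (M)\<close>

lemma ST0_iff:
  "ST0 n \<alpha>1 \<alpha>2 \<beta>1 \<beta>2 \<longleftrightarrow> (\<forall>i\<in>{1..2*n}.
     of_bool (i \<in> \<alpha>1) + of_bool (i \<in> \<alpha>2) = (of_bool (i \<in> \<beta>1) + of_bool (i \<in> \<beta>2) :: int))"
  unfolding ST0_def by (intro ball_cong refl) auto

lemma ST0_card: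
  assumes "ST0 n \<alpha>1 \<alpha>2 \<beta>1 \<beta>2" "L \<subseteq> {1..2*n}"
  shows "card (\<alpha>1 \<inter> L) + card (\<alpha>2 \<inter> L) = card (\<beta>1 \<inter> L) + card (\<beta>2 \<inter> L)"
proof -
  have fin: "finite L" using assms(2) finite_subset by blast
  have c: "int (card (\<gamma> \<inter> L)) = (\<Sum>i\<in>L. of_bool (i \<in> \<gamma>))" for \<gamma>
    using fin by (simp add: Int_commute Int_def)
  have "int (card (\<alpha>1 \<inter> L) + card (\<alpha>2 \<inter> L)) = int (card (\<beta>1 \<inter> L) + card (\<beta>2 \<inter> L))"
    unfolding of_nat_add c sum.distrib[symmetric]
    using assms unfolding ST0_iff by (intro sum.cong refl) blast
  then show ?thesis by linarith
qed

text \<open>Summing ST0 over an interval gives the equality of sums in (M). Conversely singletons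
  are intervals, and the equality of sums on them is ST0.\<close>

lemma condition_M_iff:
  "ST0 n \<alpha>1 \<alpha>2 \<beta>1 \<beta>2 \<and> interval_max_condition n \<alpha>1 \<alpha>2 \<beta>1 \<beta>2 \<longleftrightarrow> condition_M n \<alpha>1 \<alpha>2 \<beta>1 \<beta>2"
proof
  assume *: "ST0 n \<alpha>1 \<alpha>2 \<beta>1 \<beta>2 \<and> interval_max_condition n \<alpha>1 \<alpha>2 \<beta>1 \<beta>2"
  show "condition_M n \<alpha>1 \<alpha>2 \<beta>1 \<beta>2"
    unfolding condition_M_def
  proof (intro allI impI)
    fix L assume L: "cyclic_interval n L"
    then have "L \<subseteq> {1..2*n}" by (simp add: cyclic_interval_def)
    with * have "card (\<alpha>1 \<inter> L) + card (\<alpha>2 \<inter> L) = card (\<beta>1 \<inter> L) + card (\<beta>2 \<inter> L)"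
      using ST0_card by blast
    moreover have "max (card (\<beta>1 \<inter> L)) (card (\<beta>2 \<inter> L)) \<le> max (card (\<alpha>1 \<inter> L)) (card (\<alpha>2 \<inter> L))"
      using * L unfolding interval_max_condition_def by blast
    ultimately show "majorizes2 (rearrange2 (card (\<alpha>1 \<inter> L)) (card (\<alpha>2 \<inter> L)))
        (rearrange2 (card (\<beta>1 \<inter> L)) (card (\<beta>2 \<inter> L)))"
      unfolding majorizes2_def rearrange2_def fst_conv snd_conv by linarith
  qed
next
  assume M: "condition_M n \<alpha>1 \<alpha>2 \<beta>1 \<beta>2"
  have "ST0 n \<alpha>1 \<alpha>2 \<beta>1 \<beta>2"
    unfolding ST0_iff
  proof
    fix i assume i: "i \<in> {1..2*n}"
    then have "cyclic_interval n {i}"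
      unfolding cyclic_interval_def by (intro conjI exI[of _ i] exI[of _ 0]) auto
    moreover have "card (\<gamma> \<inter> {i}) = of_bool (i \<in> \<gamma>)" for \<gamma> by auto
    ultimately have "majorizes2 (rearrange2 (of_bool (i \<in> \<alpha>1)) (of_bool (i \<in> \<alpha>2)))
        (rearrange2 (of_bool (i \<in> \<beta>1)) (of_bool (i \<in> \<beta>2)))"
      using M unfolding condition_M_def by metis
    then show "of_bool (i \<in> \<alpha>1) + of_bool (i \<in> \<alpha>2) = (of_bool (i \<in> \<beta>1) + of_bool (i \<in> \<beta>2) :: int)"
      by (auto simp: majorizes2_def rearrange2_def of_bool_def split: if_splits)
  qed
  then show "ST0 n \<alpha>1 \<alpha>2 \<beta>1 \<beta>2 \<and> interval_max_condition n \<alpha>1 \<alpha>2 \<beta>1 \<beta>2"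
    using M unfolding condition_M_def interval_max_condition_def majorizes2_def rearrange2_def by simp
qed

lemma bounded_imp_conditions:
  assumes bd: "ratio_bounded_by n k \<alpha>1 \<alpha>2 \<beta>1 \<beta>2"
    and idx: "index_set n \<alpha>1" "index_set n \<alpha>2" "index_set n \<beta>1" "index_set n \<beta>2"
  shows "ST0 n \<alpha>1 \<alpha>2 \<beta>1 \<beta>2 \<and> interval_max_condition n \<alpha>1 \<alpha>2 \<beta>1 \<beta>2"
proof
  note eq = bounded_imp_equal_counts[OF bd idx]
  show "ST0 n \<alpha>1 \<alpha>2 \<beta>1 \<beta>2"
    unfolding ST0_iff
  proof
    fix i :: nat
    have "card (\<gamma> \<inter> {i}) = of_bool (i \<in> \<gamma>)" for \<gamma> by auto
    then show "of_bool (i \<in> \<alpha>1) + of_bool (i \<in> \<alpha>2) = (of_bool (i \<in> \<beta>1) + of_bool (i \<in> \<beta>2) :: int)"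
      using eq[of "{i}"] by (auto simp: of_bool_def split: if_splits)
  qed
  show "interval_max_condition n \<alpha>1 \<alpha>2 \<beta>1 \<beta>2"
    unfolding interval_max_condition_def
  proof (intro allI impI)
    fix L assume "cyclic_interval n L"
    then obtain i m where L: "L \<subseteq> {1..2*n}" "L = {i..i + m} \<or> {1..2*n} - L = {i..i + m}"
      unfolding cyclic_interval_def by blast
    have i: "i \<ge> 1" using L by (metis Diff_subset atLeastAtMost_iff le_add1 order_refl subsetD)
    define I where "I = {i..i + m}"
    have main: "\<bar>int (card (\<beta>1 \<inter> I)) - int (card (\<beta>2 \<inter> I))\<bar> \<le> \<bar>int (card (\<alpha>1 \<inter> I)) - int (card (\<alpha>2 \<inter> I))\<bar>"
      unfolding I_def by (rule bounded_imp_abs_diff_le[OF bd idx i])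
    have "\<bar>int (card (\<beta>1 \<inter> L)) - int (card (\<beta>2 \<inter> L))\<bar> \<le> \<bar>int (card (\<alpha>1 \<inter> L)) - int (card (\<alpha>2 \<inter> L))\<bar>"
    proof (cases "L = I")
      case False
      then have I: "I = {1..2*n} - L" using L by (simp add: I_def)
      \<comment> \<open>Passing to the complement replaces each count by \<open>n\<close> minus it,
        which leaves absolute differences unchanged.\<close>
      have "int (card (\<gamma> \<inter> L)) = int n - int (card (\<gamma> \<inter> I))" if "index_set n \<gamma>" for \<gamma>
      proof -
        have "\<gamma> = (\<gamma> \<inter> L) \<union> (\<gamma> \<inter> I)" "(\<gamma> \<inter> L) \<inter> (\<gamma> \<inter> I) = {}" "finite \<gamma>"
          using that finite_subset by (auto simp: I index_set_def)
        then have "card \<gamma> = card (\<gamma> \<inter> L) + card (\<gamma> \<inter> I)"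
          by (metis card_Un_disjoint finite_Int)
        then show ?thesis using that by (simp add: index_set_def)
      qed
      then show ?thesis using main idx by simp
    qed (use main in simp)
    then show "max (card (\<beta>1 \<inter> L)) (card (\<beta>2 \<inter> L)) \<le> max (card (\<alpha>1 \<inter> L)) (card (\<alpha>2 \<inter> L))"
      using max_le_iff_abs_diff_le[OF eq[of L]] by blast
  qed
qed

lemma conditions_imp_product:
  assumes "n \<ge> 1" and idx: "index_set n \<alpha>1" "index_set n \<alpha>2" "index_set n \<beta>1" "index_set n \<beta>2"
    and ST0: "ST0 n \<alpha>1 \<alpha>2 \<beta>1 \<beta>2" and max: "interval_max_condition n \<alpha>1 \<alpha>2 \<beta>1 \<beta>2"
  shows "product_of_basic_ratios n (formal_ratio \<alpha>1 \<alpha>2 \<beta>1 \<beta>2)"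
proof (rule product_if_dominates[OF assms(1) idx])
  show "of_bool (x \<in> \<alpha>1) + of_bool (x \<in> \<alpha>2) = (of_bool (x \<in> \<beta>1) + of_bool (x \<in> \<beta>2) :: int)" for x
  proof (cases "x \<in> {1..2*n}")
    case True
    then show ?thesis using ST0 unfolding ST0_iff by blast
  next
    case False
    then have "x \<notin> \<alpha>1" "x \<notin> \<alpha>2" "x \<notin> \<beta>1" "x \<notin> \<beta>2" using idx by (auto simp: index_set_def)
    then show ?thesis by simp
  qed
  let ?H = "height n \<alpha>1 \<alpha>2" and ?K = "height n \<beta>1 \<beta>2"
  have window: "\<bar>?K j - ?K i\<bar> \<le> \<bar>?H j - ?H i\<bar>" if ij: "i < j" "j \<le> 2 * n" for i j
  proof -
    \<comment> \<open>Position \<open>k\<close> carries the element \<open>Suc k\<close>, so the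
      steps at the positions \<open>{i..<j}\<close> belong to the elements
      \<open>{Suc i..j}\<close>.\<close>
    define L where "L = {Suc i..j}"
    have diff: "height n \<gamma>1 \<gamma>2 j - height n \<gamma>1 \<gamma>2 i = int (card (\<gamma>1 \<inter> L)) - int (card (\<gamma>2 \<inter> L))" for \<gamma>1 \<gamma>2
    proof -
      have "card (\<gamma> \<inter> {1..j}) = card (\<gamma> \<inter> {1..i}) + card (\<gamma> \<inter> L)" for \<gamma> :: "nat set"
      proof -
        have "\<gamma> \<inter> {1..j} = (\<gamma> \<inter> {1..i}) \<union> (\<gamma> \<inter> L)" using ij by (auto simp: L_def)
        then show ?thesis by (simp only:) (rule card_Un_disjoint, auto simp: L_def)
      qed
      then show ?thesis using ij by (simp add: height_eq_card)
    qed
    have L: "L \<subseteq> {1..2*n}" using ij by (auto simp: L_def)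
    have "L = {Suc i..Suc i + (j - Suc i)}" using ij by (auto simp: L_def)
    then have "cyclic_interval n L" using L unfolding cyclic_interval_def by blast
    then have "max (card (\<beta>1 \<inter> L)) (card (\<beta>2 \<inter> L)) \<le> max (card (\<alpha>1 \<inter> L)) (card (\<alpha>2 \<inter> L))"
      using max unfolding interval_max_condition_def by blast
    then show ?thesis
      unfolding diff using max_le_iff_abs_diff_le[OF ST0_card[OF ST0 L]] by blast
  qed
  show "dominates n \<alpha>1 \<alpha>2 \<beta>1 \<beta>2"
    unfolding dominates_def
  proof (intro allI)
    fix i j
    \<comment> \<open>Reducing positions modulo \<open>2 * n\<close> keeps the heights and brings
      both ends into one period, so intervals that do not wrap suffice.\<close>
    define i' j' where "i' = i mod (2 * n)" and "j' = j mod (2 * n)"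
    have lt: "i' \<le> 2 * n" "j' \<le> 2 * n" using assms(1) by (simp_all add: i'_def j'_def less_imp_le)
    have "height n \<gamma>1 \<gamma>2 i = height n \<gamma>1 \<gamma>2 i'" "height n \<gamma>1 \<gamma>2 j = height n \<gamma>1 \<gamma>2 j'"
      if "index_set n \<gamma>1" "index_set n \<gamma>2" for \<gamma>1 \<gamma>2
      using that by (auto intro!: height_cong simp: cyc_def i'_def j'_def)
    moreover have "\<bar>?K i' - ?K j'\<bar> \<le> \<bar>?H i' - ?H j'\<bar>"
      using window[of i' j'] window[of j' i'] lt
      by (cases i' j' rule: linorder_cases) (auto simp: abs_minus_commute)
    ultimately show "\<bar>?K i - ?K j\<bar> \<le> \<bar>?H i - ?H j\<bar>" using idx by simp
  qed
qed

theorem theorem32: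
  fixes n :: nat and \<alpha>1 \<alpha>2 \<beta>1 \<beta>2 :: "nat set"
  assumes "n \<ge> 1"
    and "index_set n \<alpha>1" and "index_set n \<alpha>2"
    and "index_set n \<beta>1" and "index_set n \<beta>2"
  shows "(ST0 n \<alpha>1 \<alpha>2 \<beta>1 \<beta>2 \<and> interval_max_condition n \<alpha>1 \<alpha>2 \<beta>1 \<beta>2
            \<longleftrightarrow> condition_M n \<alpha>1 \<alpha>2 \<beta>1 \<beta>2) \<and>
         (ST0 n \<alpha>1 \<alpha>2 \<beta>1 \<beta>2 \<and> interval_max_condition n \<alpha>1 \<alpha>2 \<beta>1 \<beta>2
            \<longleftrightarrow> product_of_basic_ratios n (formal_ratio \<alpha>1 \<alpha>2 \<beta>1 \<beta>2)) \<and>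
         (product_of_basic_ratios n (formal_ratio \<alpha>1 \<alpha>2 \<beta>1 \<beta>2)
            \<longleftrightarrow> ratio_bounded_by n 1 \<alpha>1 \<alpha>2 \<beta>1 \<beta>2) \<and>
         (ratio_bounded_by n 1 \<alpha>1 \<alpha>2 \<beta>1 \<beta>2
            \<longleftrightarrow> ratio_bounded n \<alpha>1 \<alpha>2 \<beta>1 \<beta>2)"
proof -
  have "product_of_basic_ratios n (formal_ratio \<alpha>1 \<alpha>2 \<beta>1 \<beta>2)"
    if "ST0 n \<alpha>1 \<alpha>2 \<beta>1 \<beta>2 \<and> interval_max_condition n \<alpha>1 \<alpha>2 \<beta>1 \<beta>2"
    using conditions_imp_product[OF assms] that by blast
  moreover have "ratio_bounded_by n 1 \<alpha>1 \<alpha>2 \<beta>1 \<beta>2"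
    if "product_of_basic_ratios n (formal_ratio \<alpha>1 \<alpha>2 \<beta>1 \<beta>2)"
    by (rule product_bounded_by_1[OF that assms(2-5)])
  moreover have "ratio_bounded n \<alpha>1 \<alpha>2 \<beta>1 \<beta>2" if "ratio_bounded_by n 1 \<alpha>1 \<alpha>2 \<beta>1 \<beta>2"
    unfolding ratio_bounded_def using that by (intro exI[of _ 1]) simp
  moreover have "ST0 n \<alpha>1 \<alpha>2 \<beta>1 \<beta>2 \<and> interval_max_condition n \<alpha>1 \<alpha>2 \<beta>1 \<beta>2"
    if "ratio_bounded n \<alpha>1 \<alpha>2 \<beta>1 \<beta>2"
    using that bounded_imp_conditions[OF _ assms(2-5)] unfolding ratio_bounded_def by blast
  ultimately show ?thesis using condition_M_iff[of n \<alpha>1 \<alpha>2 \<beta>1 \<beta>2] by blast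
qed

end
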